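(* Let $r,k,m,q$ be positive integers and define $A=\frac{k}{r}$. Then $\mathsf{lh}^{k,r,q}_{0;(m)}$ is non-zero if and only if $b=\frac{m-q}{q(r-1)+k}$ is a non-negative integer, and in that case $$\mathsf{lh}^{k,r,q}_{0;(m)}=\frac{b!}{m\,(b(r-1)+1)}\binom{\frac{m}{A}}{b}A^b .$$
   Context: **Fock space.** Let $\Lambda=\mathbb{C}[p_1,p_2,\dots]$; for $j>0$ let $J_j=j\,\partial/\partial p_j$ and let $J_{-j}$ be multiplication by $p_j$. For an operator $A$ on $\Lambda$, $\langle A\rangle$ is the constant term of $A\cdot 1$. Let $\varsigma(u)=e^{u/2}-e^{-u/2}$. For $n\in\mathbb{Z}$, $$\mathcal{E}_n(u)=\frac{1}{\varsigma(u)}\sum_{N\ge 0}\frac{1}{N!}\sum_{\substack{j_1,\dots,j_N\in\mathbb{Z}\setminus\{0\}\\ j_1+\dots+j_N=n}}\ \prod_{i=1}^N\frac{\varsigma(j_iu)}{j_i}\ {:}J_{j_1}\cdots J_{j_N}{:}$$ where ${:}\ {:}$ moves all $J_j$ with $j<0$ to the left (the $N=0$ term is $\delta_{n,0}/\varsigma(u)$). For $r\ge 0$, $\mathcal{F}_r^k$ is $r!$ times the coefficient of $u^r$ in $\mathcal{E}_{-k}(u)$. For operators $A_1,\dots,A_N$, the connected expectation is $\langle A_1\cdots A_N\rangle^\circ=\sum_{\pi}(-1)^{|\pi|-1}(|\pi|-1)!\prod_{B\in\pi}\langle\prod_{i\in B}A_i\rangle$, summed over set partitions $\pi$ of $\{1,\dots,N\}$,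 with the factors in each block in increasing order of index. **Orbifold completed cycles leaky Hurwitz numbers in genus 0.** Let $k,r,q$ be positive integers and $\mu=(\mu_1,\dots,\mu_n)$ a tuple of positive integers. Put $b=\frac{|\mu|+q(n-2)}{q(r-1)+k}$ and $\ell=(r-1)b+2-n$. If $b$ and $\ell$ are non-negative integers, then $$\mathsf{lh}^{k,r,q}_{0;\mu}=\frac{1}{\ell!\,q^\ell\prod_i\mu_i}\Big\langle J_{\mu_1}\cdots J_{\mu_n}\Big(\frac{\mathcal{F}_r^k}{r}\Big)^bJ_{-q}^{\ell}\Big\rangle^\circ$$ (connected expectation with $n+b+\ell$ factors); otherwise $\mathsf{lh}^{k,r,q}_{0;\mu}=0$. For $\mu=(m)$ this gives $b=\frac{m-q}{q(r-1)+k}$. $\binom{a}{b}=\frac{a(a-1)\cdots(a-b+1)}{b!}$ for rational $a$ and integer $b\ge0$. *)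

theory Defs
  imports Complex_Main
    "HOL-Library.Poly_Mapping"
    "HOL-Library.Disjoint_Sets"
    "HOL-Computational_Algebra.Formal_Laurent_Series"
begin

section \<open>Fock space\<close>

text \<open>
  The Fock space is the polynomial ring in the countably many variables $p_1, p_2, \dots$ over the
  complex numbers, as a monoid algebra. The variables are enumerated by all of \<^typ>\<open>nat\<close>: index
  \<open>i\<close> stands for $p_{i+1}$, so that no superfluous variable is present.
\<close>

type_synonym fock = "(nat \<Rightarrow>\<^sub>0 nat) \<Rightarrow>\<^sub>0 complex"

type_synonym fock_op = "fock \<Rightarrow> fock"

definition p_var :: "nat \<Rightarrow> fock" where
  "p_var j = Poly_Mapping.single (Poly_Mapping.single (j - 1) 1) 1"

definition p_deriv :: "nat \<Rightarrow> fock_op" where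
  "p_deriv j f = (\<Sum>a\<in>Poly_Mapping.keys f.
     Poly_Mapping.single (a - Poly_Mapping.single (j - 1) (1::nat))
       (of_nat (Poly_Mapping.lookup a (j - 1)) * Poly_Mapping.lookup f a))"

definition scal :: "complex \<Rightarrow> fock_op" where
  "scal c f = Poly_Mapping.single 0 c * f"

text \<open>The value at \<open>j = 0\<close> is a dummy that is never used.\<close>

definition J :: "int \<Rightarrow> fock_op" where
  "J j f = (if j > 0 then scal (of_int j) (p_deriv (nat j) f)
            else if j < 0 then p_var (nat (- j)) * f
            else 0)"

definition op_prod :: "fock_op list \<Rightarrow> fock_op" where
  "op_prod As = foldr (\<circ>) As id"

definition vev :: "fock_op \<Rightarrow> complex" where
  "vev A = Poly_Mapping.lookup (A 1) 0"

definition normal_ordered :: "int list \<Rightarrow> fock_op" where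
  "normal_ordered js = op_prod (map J (filter (\<lambda>j. j < 0) js @ filter (\<lambda>j. \<not> j < 0) js))"


section \<open>The operators \<open>\<E>\<close> and \<open>\<F>\<close>\<close>

text \<open>\<open>varsigma c\<close> is the series $\varsigma(cu)$ in the formal variable $u$.\<close>

definition varsigma :: "complex \<Rightarrow> complex fls" where
  "varsigma c = fps_to_fls (fps_exp (c / 2) - fps_exp (- c / 2))"

definition E_weight :: "int list \<Rightarrow> complex fls" where
  "E_weight js = 1 / varsigma 1 * fls_const (1 / fact (length js)) *
                   (\<Prod>j\<leftarrow>js. varsigma (of_int j) * fls_const (1 / of_int j))"

text \<open>
  \<open>E_coeff n d\<close> is the coefficient of $u^d$ in $\mathcal{E}_n(u)$. The double sum over \<open>N\<close> and over
  \<open>N\<close>-tuples is a single sum over lists. The infinite sum of operators is understood pointwise: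
  on each vector all but finitely many terms vanish (see \<open>finite_E_support\<close> below), and exactly
  those terms are dropped.
\<close>

definition E_support :: "int \<Rightarrow> fock \<Rightarrow> int list set" where
  "E_support n f = {js. 0 \<notin> set js \<and> sum_list js = n \<and> normal_ordered js f \<noteq> 0}"

definition E_coeff :: "int \<Rightarrow> int \<Rightarrow> fock_op" where
  "E_coeff n d f = (\<Sum>js\<in>E_support n f. scal (fls_nth (E_weight js) d) (normal_ordered js f))"

definition F_op :: "nat \<Rightarrow> nat \<Rightarrow> fock_op" where
  "F_op k r f = scal (fact r) (E_coeff (- int k) (int r) f)"


section \<open>Connected expectations and leaky Hurwitz numbers\<close>

definition connected_vev :: "fock_op list \<Rightarrow> complex" where
  "connected_vev As = (\<Sum>\<pi> | partition_on {..<length As} \<pi>.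
      (-1) ^ (card \<pi> - 1) * fact (card \<pi> - 1) * (\<Prod>B\<in>\<pi>. vev (op_prod (nths As B))))"

definition lh_b :: "nat \<Rightarrow> nat \<Rightarrow> nat \<Rightarrow> nat list \<Rightarrow> rat" where
  "lh_b k r q \<mu> = (of_nat (sum_list \<mu>) + of_nat q * (of_nat (length \<mu>) - 2)) /
                    (of_nat q * (of_nat r - 1) + of_nat k)"

definition lh_l :: "nat \<Rightarrow> nat \<Rightarrow> nat \<Rightarrow> nat list \<Rightarrow> rat" where
  "lh_l k r q \<mu> = (of_nat r - 1) * lh_b k r q \<mu> + 2 - of_nat (length \<mu>)"

text \<open>\<open>lh0 k r q \<mu>\<close> is the genus 0 number $\mathsf{lh}^{k,r,q}_{0;\mu}$.\<close>

definition lh0 :: "nat \<Rightarrow> nat \<Rightarrow> nat \<Rightarrow> nat list \<Rightarrow> complex" where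
  "lh0 k r q \<mu> =
     (if lh_b k r q \<mu> \<in> \<nat> \<and> lh_l k r q \<mu> \<in> \<nat> then
        let b = nat \<lfloor>lh_b k r q \<mu>\<rfloor>; l = nat \<lfloor>lh_l k r q \<mu>\<rfloor>
        in 1 / (fact l * of_nat q ^ l * of_nat (prod_list \<mu>)) *
             connected_vev (map (\<lambda>m. J (int m)) \<mu> @
                            replicate b (\<lambda>f. scal (1 / of_nat r) (F_op k r f)) @
                            replicate l (J (- int q)))
      else 0)"


section \<open>Local finiteness of \<open>\<E>\<close>\<close>

definition wdeg :: "(nat \<Rightarrow>\<^sub>0 nat) \<Rightarrow> int" where
  "wdeg a = (\<Sum>i\<in>Poly_Mapping.keys a. (int i + 1) * int (Poly_Mapping.lookup a i))"

definition wdeg_le :: "int \<Rightarrow> fock \<Rightarrow> bool" where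
  "wdeg_le D f \<longleftrightarrow> (\<forall>a\<in>Poly_Mapping.keys f. wdeg a \<le> D)"

lemma wdeg_nonneg: "wdeg a \<ge> 0"
  unfolding wdeg_def by (intro sum_nonneg) auto

lemma wdeg_superset:
  assumes "finite S" "Poly_Mapping.keys a \<subseteq> S"
  shows "wdeg a = (\<Sum>i\<in>S. (int i + 1) * int (Poly_Mapping.lookup a i))"
  unfolding wdeg_def using assms by (intro sum.mono_neutral_left) (auto simp: in_keys_iff)

lemma keys_scal: "Poly_Mapping.keys (scal c f) \<subseteq> Poly_Mapping.keys f"
  unfolding scal_def using keys_mult[of "Poly_Mapping.single 0 c" f]
  by (cases "c = 0") auto

lemma wdeg_le_J:
  assumes "wdeg_le D f" "j > 0"
  shows "wdeg_le (D - j) (J j f)"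
proof -
  let ?i = "nat j - 1"
  have "wdeg c \<le> D - j" if c: "c \<in> Poly_Mapping.keys (J j f)" for c
  proof -
    have "c \<in> Poly_Mapping.keys (p_deriv (nat j) f)"
      using c assms(2) keys_scal by (auto simp: J_def)
    then obtain a where a: "a \<in> Poly_Mapping.keys f"
      "c \<in> Poly_Mapping.keys (Poly_Mapping.single (a - Poly_Mapping.single ?i (1::nat))
                     (of_nat (Poly_Mapping.lookup a ?i) * Poly_Mapping.lookup f a))"
      unfolding p_deriv_def using keys_sum by fastforce
    then have ca: "c = a - Poly_Mapping.single ?i 1" and nz: "Poly_Mapping.lookup a ?i \<noteq> 0"
      by (auto split: if_splits)
    have sub: "Poly_Mapping.keys c \<subseteq> Poly_Mapping.keys a"
      by (auto simp: ca in_keys_iff lookup_minus)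
    have mem: "?i \<in> Poly_Mapping.keys a"
      using nz by (simp add: in_keys_iff)
    have "wdeg c = (\<Sum>i\<in>Poly_Mapping.keys a. (int i + 1) * int (Poly_Mapping.lookup c i))"
      by (rule wdeg_superset) (use sub in auto)
    also have "\<dots> = (\<Sum>i\<in>Poly_Mapping.keys a. (int i + 1) * int (Poly_Mapping.lookup a i) - (if i = ?i then j else 0))"
      using nz assms(2)
      by (intro sum.cong) (auto simp: ca lookup_minus lookup_single when_def of_nat_diff algebra_simps)
    also have "\<dots> = wdeg a - j"
      using mem by (simp add: sum_subtractf wdeg_def)
    also have "\<dots> \<le> D - j"
      using assms(1) a(1) by (auto simp: wdeg_le_def)
    finally show ?thesis .
  qed
  then show ?thesis by (auto simp: wdeg_le_def)
qed

lemma wdeg_le_op_prod: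
  assumes "\<forall>j\<in>set js. j > 0" "wdeg_le D f"
  shows "wdeg_le (D - sum_list js) (op_prod (map J js) f)"
  using assms
proof (induction js)
  case (Cons j js)
  then show ?case
    using wdeg_le_J[of "D - sum_list js" "op_prod (map J js) f" j]
    by (auto simp: op_prod_def algebra_simps)
qed (auto simp: op_prod_def)

lemma wdeg_le_neg:
  assumes "wdeg_le D f" "D < 0"
  shows "f = 0"
proof (rule ccontr)
  assume "f \<noteq> 0"
  then obtain a where a: "a \<in> Poly_Mapping.keys f" by (metis keys_eq_empty ex_in_conv)
  have "wdeg a \<ge> 0" by (rule wdeg_nonneg)
  with a assms show False by (force simp: wdeg_le_def)
qed

lemma op_prod_append: "op_prod (As @ Bs) f = op_prod As (op_prod Bs f)"
  by (induction As) (auto simp: op_prod_def)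

lemma op_prod_J_neg_zero: "\<forall>j\<in>set js. j < 0 \<Longrightarrow> op_prod (map J js) 0 = 0"
  by (induction js) (auto simp: op_prod_def J_def)

lemma sum_list_signs:
  fixes js :: "int list"
  shows "sum_list (filter (\<lambda>j. j < 0) js) + sum_list (filter (\<lambda>j. \<not> j < 0) js) = sum_list js"
    and "(\<Sum>j\<leftarrow>js. \<bar>j\<bar>) = sum_list (filter (\<lambda>j. \<not> j < 0) js) - sum_list (filter (\<lambda>j. j < 0) js)"
  by (induction js) auto

lemma length_le_sum_list_abs:
  fixes js :: "int list"
  shows "0 \<notin> set js \<Longrightarrow> int (length js) \<le> (\<Sum>j\<leftarrow>js. \<bar>j\<bar>)"
  by (induction js) auto

lemma abs_le_sum_list_abs:
  fixes js :: "int list"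
  shows "j \<in> set js \<Longrightarrow> \<bar>j\<bar> \<le> (\<Sum>i\<leftarrow>js. \<bar>i\<bar>)"
proof -
  have "\<bar>j\<bar> \<le> (\<Sum>i\<leftarrow>js. \<bar>i\<bar>) \<and> 0 \<le> (\<Sum>i\<leftarrow>js. \<bar>i\<bar>)" if "j \<in> set js"
    using that by (induction js) (auto intro!: add_nonneg_nonneg sum_list_nonneg)
  then show "j \<in> set js \<Longrightarrow> \<bar>j\<bar> \<le> (\<Sum>i\<leftarrow>js. \<bar>i\<bar>)" by blast
qed

lemma finite_E_support: "finite (E_support n f)"
proof -
  define D where "D = (\<Sum>a\<in>Poly_Mapping.keys f. wdeg a)"
  have D: "wdeg_le D f"
    unfolding wdeg_le_def D_def by (auto intro!: member_le_sum wdeg_nonneg)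
  define M where "M = nat (2 * D + \<bar>n\<bar>)"
  have "set js \<subseteq> {- int M..int M} \<and> length js \<le> M" if js: "js \<in> E_support n f" for js
  proof -
    let ?N = "filter (\<lambda>j. j < 0) js" and ?P = "filter (\<lambda>j. \<not> j < 0) js"
    have z: "0 \<notin> set js" and s: "sum_list js = n" and nz: "normal_ordered js f \<noteq> 0"
      using js by (auto simp: E_support_def)
    have "op_prod (map J ?P) f \<noteq> 0"
      using nz op_prod_J_neg_zero[of ?N] by (auto simp: normal_ordered_def op_prod_append)
    moreover have "\<forall>j\<in>set ?P. j > 0"
      using z by (auto simp: not_less order.order_iff_strict)
    ultimately have P: "sum_list ?P \<le> D"
      using wdeg_le_neg[OF wdeg_le_op_prod[OF _ D, of ?P]] by (meson diff_less_0_iff_less not_le)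
    have abs: "(\<Sum>j\<leftarrow>js. \<bar>j\<bar>) \<le> 2 * D + \<bar>n\<bar>"
      using sum_list_signs[of js] P s by linarith
    have "length js \<le> M"
      using length_le_sum_list_abs[OF z] abs unfolding M_def by linarith
    moreover have "j \<in> {- int M..int M}" if "j \<in> set js" for j
      using abs_le_sum_list_abs[OF that] abs unfolding M_def atLeastAtMost_iff by linarith
    ultimately show ?thesis by blast
  qed
  then have "E_support n f \<subseteq> {js. set js \<subseteq> {- int M..int M} \<and> length js \<le> M}" by blast
  then show ?thesis
    using finite_lists_length_le[of "{- int M..int M}" M] finite_subset by blast
qed

end

theory Submission
  imports Defs
begin

text \<open>
  All factors of the expectation except \<open>J\<^sub>m\<close> produce polynomials without constant term, so the
  connected expectation equals the ordinary one, which is \<open>m\<close> times the coefficient of \<open>p\<^sub>m\<close> in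
  \<open>(F/r)\<^sup>b p\<^sub>q\<^sup>l\<close>, where \<open>l = (r - 1) b + 1\<close>. Each application of \<open>F\<close> lowers the polynomial degree by
  at most \<open>r - 1\<close>, and by exactly \<open>r - 1\<close> only through terms with one creation and \<open>r\<close> annihilation
  operators. To get from degree \<open>l\<close> to degree \<open>1\<close> only these terms can contribute.

  The leading part \<open>G\<close> of \<open>F/r\<close> is linear in the creation operators, so its flow preserves the family
  \<open>exp (\<Sum> x\<^sub>i p\<^sub>i)\<close>. Starting from \<open>exp p\<^sub>q\<close>, this yields
  \<open>G\<^sup>b p\<^sub>q\<^sup>l = b! l! / d! [s\<^sup>b] P(s)\<^sup>d\<close> with \<open>d = l - (r - 1) b\<close> and \<open>P(s) = \<Sum> \<phi>\<^sub>j p\<^bsub>e(j)\<^esub> s\<^sup>j\<close>, where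
  \<open>e(j) = q + j (q (r - 1) + k)\<close> and the \<open>\<phi>\<^sub>j\<close> satisfy
  \<open>r (n + 1) \<phi>\<^bsub>n+1\<^esub> = [s\<^sup>n] (\<Sum> e(j) \<phi>\<^sub>j s\<^sup>j)\<^sup>r\<close>. The Rothe-Hagen identity solves this recursion in closed form.
\<close>

section \<open>Rothe numbers\<close>

text \<open>The coefficient of \<open>u ^ n\<close> in \<open>B ^ x\<close>, where
  \<open>B = 1 + u * B ^ \<beta>\<close> is the generalized binomial series. The usual form has the
  denominator \<open>x + \<beta> * n\<close>; absorbing it leaves a polynomial in
  \<open>x\<close>.\<close>

definition rothe :: "'a::field_char_0 \<Rightarrow> 'a \<Rightarrow> nat \<Rightarrow> 'a" where
  "rothe \<beta> x n = (if n = 0 then 1 else x / of_nat n * ((x + \<beta> * of_nat n - 1) gchoose (n - 1)))"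

lemma rothe_0 [simp]: "rothe \<beta> x 0 = 1"
  by (simp add: rothe_def)

lemma rothe_zero: "rothe \<beta> 0 n = (if n = 0 then 1 else 0)"
  by (simp add: rothe_def)

text \<open>Coefficient form of \<open>B ^ x - B ^ (x - 1) = u * B ^ (x - 1 + \<beta>)\<close>;
  Pascal's rule drives the proof.\<close>

lemma rothe_diff: "rothe \<beta> x (Suc n) - rothe \<beta> (x - 1) (Suc n) = rothe \<beta> (x - 1 + \<beta>) n"
proof (cases n)
  case (Suc k)
  \<comment> \<open>With this \<open>z\<close> the three Rothe numbers have upper arguments
    \<open>z + 1\<close>, \<open>z\<close> and \<open>z\<close>, so everything reduces to
    \<open>z gchoose k\<close>.\<close>
  define z where "z = x + \<beta> * of_nat (Suc n) - 2"
  have 1: "(z + 1) gchoose n = (z gchoose k) + (z gchoose n)"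
    using gbinomial_Suc_Suc[of z k] by (simp add: Suc)
  have 2: "of_nat n * (z gchoose n) = (z - of_nat k) * (z gchoose k)"
    using gbinomial_mult_1[of z k] by (simp add: Suc algebra_simps)
  have n: "of_nat n \<noteq> (0::'a)" "of_nat (Suc n) \<noteq> (0::'a)" by (auto simp: Suc simp del: of_nat_Suc)
  have 3: "of_nat (Suc n) * rothe \<beta> x (Suc n) = x * ((z + 1) gchoose n)"
    using n unfolding rothe_def z_def by (simp add: diff_add_eq del: of_nat_Suc)
  have 4: "of_nat (Suc n) * rothe \<beta> (x - 1) (Suc n) = (x - 1) * (z gchoose n)"
  proof -
    have "x - 1 + \<beta> * of_nat (Suc n) - 1 = z" by (simp add: z_def)
    then show ?thesis using n unfolding rothe_def by (simp del: of_nat_Suc)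
  qed
  have 5: "(x - 1 + \<beta>) * (z gchoose k) = of_nat n * rothe \<beta> (x - 1 + \<beta>) n"
  proof -
    have "x - 1 + \<beta> + \<beta> * of_nat n - 1 = z" by (simp add: z_def algebra_simps)
    then show ?thesis using n by (simp add: rothe_def Suc)
  qed
  have "of_nat n * (of_nat (Suc n) * (rothe \<beta> x (Suc n) - rothe \<beta> (x - 1) (Suc n)))
      = of_nat n * (x * ((z + 1) gchoose n) - (x - 1) * (z gchoose n))"
    by (simp only: right_diff_distrib 3 4)
  also have "\<dots> = of_nat n * x * (z gchoose k) + of_nat n * (z gchoose n)"
    unfolding 1 by (simp add: algebra_simps)
  also have "\<dots> = (of_nat n * x + z - of_nat k) * (z gchoose k)"
    unfolding 2 by (simp add: algebra_simps)
  also have "\<dots> = of_nat (Suc n) * (x - 1 + \<beta>) * (z gchoose k)"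
    by (simp add: z_def Suc algebra_simps)
  also have "\<dots> = of_nat n * (of_nat (Suc n) * rothe \<beta> (x - 1 + \<beta>) n)"
    using 5 by (simp only: mult.assoc mult.left_commute)
  finally show ?thesis using n by (simp only: mult_cancel_left) auto
qed (simp add: rothe_def)

lemma rothe_poly: "\<exists>p. \<forall>x. rothe \<beta> x n = poly p x"
proof (cases n)
  case 0
  then show ?thesis by (auto intro: exI[of _ 1])
next
  case (Suc k)
  have "rothe \<beta> x n = poly (smult (1 / (of_nat n * fact k)) ([:0, 1:] * (\<Prod>i<k. [:\<beta> * of_nat n - 1 - of_nat i, 1:]))) x" for x
    by (simp add: rothe_def Suc gbinomial_prod_rev poly_prod atLeast0LessThan algebra_simps)
  then show ?thesis by blast
qed

lemma poly_eq_on_nats: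
  fixes p :: "'a::field_char_0 poly"
  assumes "\<And>n::nat. poly p (of_nat n) = poly p' (of_nat n)"
  shows "p = p'"
proof (rule ccontr)
  assume "p \<noteq> p'"
  then have "finite {x. poly (p - p') x = 0}" by (intro poly_roots_finite) simp
  moreover have "range of_nat \<subseteq> {x. poly (p - p') x = 0}" using assms by auto
  ultimately have "finite (range (of_nat :: nat \<Rightarrow> 'a))" by (rule finite_subset[rotated])
  then show False using finite_imageD infinite_UNIV_nat inj_of_nat by blast
qed

text \<open>
  Both sides are polynomials in \<open>x\<close> that agree at \<open>x = 0\<close> and, by induction on \<open>n\<close>, have the same
  difference \<open>x \<mapsto> x - 1\<close>.
\<close>

lemma rothe_hagen:
  "(\<Sum>i\<le>n. rothe \<beta> x i * rothe \<beta> y (n - i)) = rothe \<beta> (x + y) n"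
proof (induction n arbitrary: x)
  case (Suc n)
  let ?C = "\<lambda>x. \<Sum>i\<le>Suc n. rothe \<beta> x i * rothe \<beta> y (Suc n - i)"
  obtain p where p: "\<And>i x. rothe \<beta> x i = poly (p i) x"
    using rothe_poly by metis
  define p1 where "p1 = (\<Sum>i\<le>Suc n. smult (rothe \<beta> y (Suc n - i)) (p i))"
  define p2 where "p2 = p (Suc n) \<circ>\<^sub>p [:y, 1:]"
  have p1: "?C x = poly p1 x" for x
    unfolding p1_def by (simp add: poly_sum p mult.commute)
  have p2: "rothe \<beta> (x + y) (Suc n) = poly p2 x" for x
    by (simp add: p2_def poly_pcompose p add.commute)
  have d: "?C x - ?C (x - 1) = rothe \<beta> (x + y) (Suc n) - rothe \<beta> (x - 1 + y) (Suc n)" for x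
  proof -
    have "?C x - ?C (x - 1) = (\<Sum>i\<le>Suc n. (rothe \<beta> x i - rothe \<beta> (x - 1) i) * rothe \<beta> y (Suc n - i))"
      by (simp only: sum_subtractf left_diff_distrib)
    \<comment> \<open>The term \<open>i = 0\<close> cancels because both Rothe numbers are 1 there;
      the shifted rest is a convolution of order \<open>n\<close>.\<close>
    also have "\<dots> = (\<Sum>i\<le>n. rothe \<beta> (x - 1 + \<beta>) i * rothe \<beta> y (n - i))"
      by (subst sum.atMost_Suc_shift) (simp add: rothe_diff)
    also have "\<dots> = rothe \<beta> (x - 1 + \<beta> + y) n" by (rule Suc)
    also have "\<dots> = rothe \<beta> (x + y) (Suc n) - rothe \<beta> (x - 1 + y) (Suc n)"
      using rothe_diff[of \<beta> "x + y" n] by (simp add: algebra_simps)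
    finally show ?thesis .
  qed
  have "poly p1 (of_nat j) = poly p2 (of_nat j)" for j
  proof (induction j)
    case 0
    show ?case unfolding p1[symmetric] p2[symmetric]
      by (subst sum.atMost_Suc_shift) (simp add: rothe_zero)
  next
    case (Suc j)
    then show ?case using d[of "of_nat (Suc j)"] unfolding p1 p2 by simp
  qed
  then have "p1 = p2" by (rule poly_eq_on_nats)
  then show ?case using p1 p2 by metis
qed simp

text \<open>Rothe-Hagen makes the generating series exponential in \<open>x\<close>, so powers scale
  the argument.\<close>

lemma rothe_power:
  "Abs_fps (rothe \<beta> x) ^ r = Abs_fps (rothe \<beta> (of_nat r * x))"
proof (induction r)
  case 0
  show ?case by (rule fps_ext) (simp add: rothe_zero)
next
  case (Suc r)
  show ?case
    by (rule fps_ext) (simp add: Suc fps_mult_nth atLeast0AtMost rothe_hagen algebra_simps)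
qed

text \<open>The usual form of the Rothe number with its denominator cleared, by absorption.\<close>

lemma rothe_gbinomial: "(x + \<beta> * of_nat n) * rothe \<beta> x n = x * ((x + \<beta> * of_nat n) gchoose n)"
proof (cases n)
  case (Suc k)
  let ?y = "x + \<beta> * of_nat n"
  have "of_nat n * (?y * rothe \<beta> x n) = x * (?y * ((?y - 1) gchoose k))"
    unfolding rothe_def by (simp add: Suc del: of_nat_Suc)
  also have "?y * ((?y - 1) gchoose k) = of_nat n * (?y gchoose n)"
    using gbinomial_absorption[of k ?y] by (simp only: Suc)
  finally have "of_nat n * (?y * rothe \<beta> x n) = of_nat n * (x * (?y gchoose n))"
    by (simp only: mult_ac)
  then show ?thesis by (simp add: Suc del: of_nat_Suc)
qed simp

text \<open>The companion to absorption: here the upper argument stays fixed while the lower index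
  rises from \<open>n - 1\<close> to \<open>n\<close>.\<close>

lemma rothe_gbinomial': "(x + (\<beta> - 1) * of_nat n) * rothe \<beta> x n = x * ((x + \<beta> * of_nat n - 1) gchoose n)"
proof (cases n)
  case (Suc k)
  define z where "z = x + \<beta> * of_nat n - 1"
  have z: "x + (\<beta> - 1) * of_nat n = z - of_nat k" by (simp add: z_def Suc algebra_simps)
  have "of_nat n * ((z - of_nat k) * rothe \<beta> x n) = x * ((z - of_nat k) * (z gchoose k))"
    unfolding rothe_def z_def[symmetric] by (simp add: Suc del: of_nat_Suc)
  also have "(z - of_nat k) * (z gchoose k) = of_nat n * (z gchoose n)"
    using gbinomial_mult_1[of z k] by (simp add: Suc algebra_simps)
  finally have "of_nat n * ((z - of_nat k) * rothe \<beta> x n) = of_nat n * (x * (z gchoose n))"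
    by (simp only: mult_ac)
  then show ?thesis unfolding z z_def[symmetric] by (simp add: Suc del: of_nat_Suc)
qed simp

text \<open>The base on the left is \<open>a * f(t X)\<close>, and substituting \<open>t X\<close>
  for \<open>X\<close> is a ring homomorphism.\<close>

lemma fps_scale_power:
  fixes f :: "'a::comm_ring_1 fps"
  shows "Abs_fps (\<lambda>n. a * t ^ n * fps_nth f n) ^ r = Abs_fps (\<lambda>n. a ^ r * t ^ n * fps_nth (f ^ r) n)"
proof (induction r)
  case 0
  show ?case by (rule fps_ext) simp
next
  case (Suc r)
  have t: "t ^ i * t ^ (n - i) = t ^ n" if "i \<le> n" for i n
    using that by (simp flip: power_add)
  show ?case
  proof (rule fps_ext)
    fix n
    have "(\<Sum>i=0..n. a * t ^ i * fps_nth f i * (a ^ r * t ^ (n - i) * fps_nth (f ^ r) (n - i)))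
        = (\<Sum>i=0..n. a * a ^ r * t ^ n * (fps_nth f i * fps_nth (f ^ r) (n - i)))"
      by (intro sum.cong refl) (simp add: t[symmetric] mult_ac)
    then show "fps_nth (Abs_fps (\<lambda>n. a * t ^ n * fps_nth f n) ^ Suc r) n =
        fps_nth (Abs_fps (\<lambda>n. a ^ Suc r * t ^ n * fps_nth (f ^ Suc r) n)) n"
      by (simp only: power_Suc Suc.IH fps_mult_nth fps_nth_Abs_fps sum_distrib_left)
  qed
qed

lemma of_rat_fact: "of_rat (fact n) = fact n"
  using of_rat_of_nat_eq[of "fact n"] by simp

lemma of_rat_gbinomial: "of_rat (a gchoose n) = (of_rat a gchoose n :: 'a::field_char_0)"
  by (simp add: gbinomial_prod_rev of_rat_divide of_rat_prod of_rat_diff of_rat_fact)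

section \<open>Differential operators on the Fock space\<close>

abbreviation const :: "complex \<Rightarrow> fock" where
  "const c \<equiv> Poly_Mapping.single 0 c"

lemma const_add: "const (a + b) = const a + const b"
  by (rule single_add)

lemma const_mult: "const (a * b) = const a * const b"
  by (simp add: mult_single)

lemma const_of_nat: "const (of_nat n) = of_nat n" by simp

lemma const_sum: "const (sum f S) = (\<Sum>x\<in>S. const (f x))"
  by (induction S rule: infinite_finite_induct) (simp_all add: const_add)

lemma lookup_const_mult: "Poly_Mapping.lookup (const c * f) a = c * Poly_Mapping.lookup f a"
  by (simp add: mult_map_scale_conv_mult[symmetric] Poly_Mapping.map.rep_eq when_def)

lemma fock_induct [case_names single add]:
  fixes f :: fock
  assumes "\<And>a c. P (Poly_Mapping.single a c)" "\<And>f g. P f \<Longrightarrow> P g \<Longrightarrow> P (f + g)"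
  shows "P f"
proof (induction f rule: update_induct)
  case const
  show ?case using assms(1)[of 0 0] by simp
next
  case (update f a b)
  have "Poly_Mapping.update a b f = f + Poly_Mapping.single a b"
    using update(1) by (intro poly_mapping_eqI)
      (auto simp: lookup_update lookup_add lookup_single in_keys_iff when_def)
  then show ?case using assms update by simp
qed

text \<open>Only the monomial \<open>b\<close> times \<open>p_j\<close> is mapped to
  \<open>b\<close>. Reading off coefficients this way makes additivity and degree bounds pointwise
  facts.\<close>

lemma lookup_p_deriv:
  "Poly_Mapping.lookup (p_deriv j f) b =
     of_nat (Suc (Poly_Mapping.lookup b (j - 1))) * Poly_Mapping.lookup f (b + Poly_Mapping.single (j - 1) 1)"
proof -
  let ?e = "Poly_Mapping.single (j - 1) (1::nat)"
  have eq: "Poly_Mapping.lookup (Poly_Mapping.single (a - ?e) (of_nat (Poly_Mapping.lookup a (j - 1)) * Poly_Mapping.lookup f a)) b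
      = (if a = b + ?e then of_nat (Suc (Poly_Mapping.lookup b (j - 1))) * Poly_Mapping.lookup f (b + ?e) else 0)" for a
  \<comment> \<open>Subtraction of exponents is truncated: if the variable is absent,
    \<open>a - ?e\<close> is \<open>a\<close> itself, but the coefficient is then 0.\<close>
  proof (cases "Poly_Mapping.lookup a (j - 1) = 0")
    case True
    then have "a \<noteq> b + ?e" by (auto simp: lookup_add)
    then show ?thesis using True by simp
  next
    case False
    then have "a - ?e + ?e = a"
      by (intro poly_mapping_eqI) (auto simp: lookup_add lookup_minus lookup_single when_def)
    then have "a - ?e = b \<longleftrightarrow> a = b + ?e" by (metis add_diff_cancel_right')
    then show ?thesis by (auto simp: lookup_single lookup_add when_def)
  qed
  show ?thesis
    unfolding p_deriv_def lookup_sum eq by (simp add: in_keys_iff)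
qed

lemma p_deriv_add: "p_deriv j (f + g) = p_deriv j f + p_deriv j g"
  by (rule poly_mapping_eqI) (simp add: lookup_p_deriv lookup_add algebra_simps)

lemma p_deriv_single:
  "p_deriv j (Poly_Mapping.single a c) =
     Poly_Mapping.single (a - Poly_Mapping.single (j - 1) 1) (of_nat (Poly_Mapping.lookup a (j - 1)) * c)"
  by (cases "c = 0") (simp_all add: p_deriv_def)

lemma p_deriv_mult: "p_deriv j (f * g) = p_deriv j f * g + f * p_deriv j g"
proof (induction f rule: fock_induct)
  case (single a x)
  show ?case
  proof (induction g rule: fock_induct)
    case (single b y)
    let ?e = "Poly_Mapping.single (j - 1) (1::nat)"
    let ?na = "Poly_Mapping.lookup a (j - 1)" and ?nb = "Poly_Mapping.lookup b (j - 1)"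
    have A: "a + b - ?e = a - ?e + b" if "?na \<noteq> 0"
      using that by (intro poly_mapping_eqI) (auto simp: lookup_add lookup_minus lookup_single when_def)
    have B: "a + b - ?e = a + (b - ?e)" if "?nb \<noteq> 0"
      using that by (intro poly_mapping_eqI) (auto simp: lookup_add lookup_minus lookup_single when_def)
    have 1: "Poly_Mapping.single (a + b - ?e) (of_nat ?na * (x * y)) = Poly_Mapping.single (a - ?e + b) (of_nat ?na * (x * y))"
      using A by (cases "?na = 0") auto
    have 2: "Poly_Mapping.single (a + b - ?e) (of_nat ?nb * (x * y)) = Poly_Mapping.single (a + (b - ?e)) (of_nat ?nb * (x * y))"
      using B by (cases "?nb = 0") auto
    have "p_deriv j (Poly_Mapping.single a x * Poly_Mapping.single b y)
      = Poly_Mapping.single (a + b - ?e) (of_nat ?na * (x * y)) + Poly_Mapping.single (a + b - ?e) (of_nat ?nb * (x * y))"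
      by (simp only: mult_single p_deriv_single lookup_add of_nat_add distrib_right single_add)
    then show ?case
      by (simp only: p_deriv_single mult_single 1 2) (simp add: algebra_simps)
  qed (simp add: p_deriv_add algebra_simps)
qed (simp add: p_deriv_add algebra_simps)

lemma J_add: "J j (f + g) = J j f + J j g"
  by (simp add: J_def scal_def p_deriv_add algebra_simps)

lemma J_0 [simp]: "J j 0 = 0"
  using J_add[of j 0 0] by simp

lemma J_mult: "j > 0 \<Longrightarrow> J j (f * g) = J j f * g + f * J j g"
  by (simp add: J_def scal_def p_deriv_mult algebra_simps)

lemma J_const [simp]: "j > 0 \<Longrightarrow> J j (const c) = 0"
  by (simp add: J_def scal_def p_deriv_single)

lemma J_const_mult: "J j (const c * f) = const c * J j f"
  by (auto simp: J_mult J_def[of j] algebra_simps) (simp_all add: scal_def p_deriv_mult p_deriv_single algebra_simps)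

lemma J_sum: "J j (sum f S) = (\<Sum>x\<in>S. J j (f x))"
  by (induction S rule: infinite_finite_induct) (simp_all add: J_add)

lemma J_p_var:
  assumes "i > 0" "j > 0"
  shows "J i (p_var j) = (if i = int j then const (of_int i) else 0)"
proof -
  have "nat i - 1 = j - 1 \<longleftrightarrow> i = int j" using assms by auto
  then show ?thesis using assms
    by (auto simp: J_def scal_def p_var_def p_deriv_single lookup_single when_def mult_single)
qed

definition J_prod :: "int list \<Rightarrow> fock_op" where
  "J_prod js = op_prod (map J js)"

lemma J_prod_Nil [simp]: "J_prod [] f = f"
  and J_prod_Cons [simp]: "J_prod (j # js) f = J j (J_prod js f)"
  by (simp_all add: J_prod_def op_prod_def)

lemma J_prod_add: "J_prod js (f + g) = J_prod js f + J_prod js g"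
  by (induction js) (simp_all add: J_add)

lemma J_prod_const_mult: "J_prod js (const c * f) = const c * J_prod js f"
  by (induction js) (simp_all add: J_const_mult)

section \<open>Lower bounds on the polynomial degree\<close>

definition mdeg :: "(nat \<Rightarrow>\<^sub>0 nat) \<Rightarrow> nat" where
  "mdeg a = (\<Sum>i\<in>Poly_Mapping.keys a. Poly_Mapping.lookup a i)"

lemma mdeg_superset:
  assumes "finite S" "Poly_Mapping.keys a \<subseteq> S"
  shows "mdeg a = (\<Sum>i\<in>S. Poly_Mapping.lookup a i)"
  unfolding mdeg_def using assms by (intro sum.mono_neutral_left) (auto simp: in_keys_iff)

lemma mdeg_add: "mdeg (a + b) = mdeg a + mdeg b"
proof -
  let ?S = "Poly_Mapping.keys a \<union> Poly_Mapping.keys b"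
  have "mdeg (a + b) = (\<Sum>i\<in>?S. Poly_Mapping.lookup (a + b) i)"
    by (rule mdeg_superset) (auto dest: keys_add[THEN subsetD])
  then show ?thesis
    by (simp add: mdeg_superset[of ?S a] mdeg_superset[of ?S b] lookup_add sum.distrib)
qed

lemma mdeg_single [simp]: "mdeg (Poly_Mapping.single i n) = n"
  by (simp add: mdeg_def)

text \<open>Bounds are integers because annihilation operators may push them below 0; the zero
  polynomial satisfies all of them.\<close>

definition mdeg_ge :: "int \<Rightarrow> fock \<Rightarrow> bool" where
  "mdeg_ge d f \<longleftrightarrow> (\<forall>a\<in>Poly_Mapping.keys f. d \<le> int (mdeg a))"

lemma mdeg_geD: "mdeg_ge d f \<Longrightarrow> int (mdeg a) < d \<Longrightarrow> Poly_Mapping.lookup f a = 0"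
  by (force simp: mdeg_ge_def in_keys_iff)

lemma mdeg_ge_mono: "mdeg_ge d f \<Longrightarrow> d' \<le> d \<Longrightarrow> mdeg_ge d' f"
  by (force simp: mdeg_ge_def)

lemma mdeg_ge_0 [simp]: "mdeg_ge d 0"
  by (simp add: mdeg_ge_def)

lemma mdeg_ge_const [simp]: "mdeg_ge 0 (const c)"
  by (simp add: mdeg_ge_def)

lemma mdeg_ge_p_var [simp]: "mdeg_ge 1 (p_var j)"
  by (simp add: mdeg_ge_def p_var_def)

lemma mdeg_ge_add: "mdeg_ge d f \<Longrightarrow> mdeg_ge d g \<Longrightarrow> mdeg_ge d (f + g)"
  unfolding mdeg_ge_def using keys_add[of f g] by auto

lemma mdeg_ge_sum: "(\<And>x. x \<in> S \<Longrightarrow> mdeg_ge d (f x)) \<Longrightarrow> mdeg_ge d (sum f S)"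
  by (induction S rule: infinite_finite_induct) (auto intro: mdeg_ge_add)

lemma mdeg_ge_mult: "mdeg_ge d f \<Longrightarrow> mdeg_ge e g \<Longrightarrow> mdeg_ge (d + e) (f * g)"
  unfolding mdeg_ge_def using keys_mult[of f g] by (force simp: mdeg_add)

lemma mdeg_ge_const_mult: "mdeg_ge d f \<Longrightarrow> mdeg_ge d (const c * f)"
  using mdeg_ge_mult[of 0 "const c" d f] by simp

lemma mdeg_ge_J_pos:
  assumes "mdeg_ge d f" "j > 0"
  shows "mdeg_ge (d - 1) (J j f)"
proof -
  let ?e = "Poly_Mapping.single (nat j - 1) (1::nat)"
  have "d - 1 \<le> int (mdeg a)" if "a \<in> Poly_Mapping.keys (J j f)" for a
  proof -
    have "Poly_Mapping.lookup f (a + ?e) \<noteq> 0"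
      using that assms(2) by (auto simp: J_def scal_def in_keys_iff lookup_const_mult lookup_p_deriv simp del: single_of_int)
    then have "d \<le> int (mdeg (a + ?e))" using assms(1) by (simp add: mdeg_ge_def in_keys_iff)
    then show ?thesis by (simp add: mdeg_add)
  qed
  then show ?thesis by (simp add: mdeg_ge_def)
qed

lemma mdeg_ge_J_neg:
  assumes "mdeg_ge d f" "j < 0"
  shows "mdeg_ge (d + 1) (J j f)"
  using mdeg_ge_mult[OF mdeg_ge_p_var assms(1)] assms(2) by (simp add: J_def add.commute)

lemma mdeg_ge_J_prod_pos:
  assumes "mdeg_ge d f" "\<forall>j\<in>set js. j > 0"
  shows "mdeg_ge (d - int (length js)) (J_prod js f)"
  using assms(2)
proof (induction js)
  case (Cons j js)
  then show ?case using mdeg_ge_J_pos[of "d - int (length js)" "J_prod js f" j] by (simp add: algebra_simps)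
qed (simp add: assms)

lemma mdeg_ge_J_prod_neg:
  assumes "mdeg_ge d f" "\<forall>j\<in>set js. j < 0"
  shows "mdeg_ge (d + int (length js)) (J_prod js f)"
  using assms(2)
proof (induction js)
  case (Cons j js)
  then show ?case using mdeg_ge_J_neg[of "d + int (length js)" "J_prod js f" j] by (simp add: algebra_simps)
qed (simp add: assms)

lemma normal_ordered_eq:
  "normal_ordered js f = J_prod (filter (\<lambda>j. j < 0) js) (J_prod (filter (\<lambda>j. \<not> j < 0) js) f)"
  by (simp add: normal_ordered_def J_prod_def op_prod_append)

text \<open>Among N operators, each of the c creation operators raises the degree by 1 and each of
  the others lowers it by 1, a total change of \<open>2 * c - N\<close>.\<close>

lemma mdeg_ge_normal_ordered:
  assumes "mdeg_ge d f" "0 \<notin> set js"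
  shows "mdeg_ge (d - int (length js) + 2 * int (length (filter (\<lambda>j. j < 0) js))) (normal_ordered js f)"
proof -
  let ?P = "filter (\<lambda>j. \<not> j < 0) js" and ?N = "filter (\<lambda>j. j < 0) js"
  have P: "\<forall>j\<in>set ?P. j > 0" using assms(2) by (auto simp: not_less order.order_iff_strict)
  have "mdeg_ge (d - int (length ?P) + int (length ?N)) (normal_ordered js f)"
    unfolding normal_ordered_eq
    by (intro mdeg_ge_J_prod_neg mdeg_ge_J_prod_pos assms P) auto
  moreover have "int (length ?P) + int (length ?N) = int (length js)"
    using sum_length_filter_compl[of "\<lambda>j. j < 0" js] by simp
  then have "d - int (length ?P) + int (length ?N) = d - int (length js) + 2 * int (length ?N)"
    by linarith
  ultimately show ?thesis by metis
qed

section \<open>The leading part of $\mathcal{F}$\<close>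

text \<open>The power series \<open>varsigma c\<close> divided by \<open>u\<close>; nothing is lost
  in the shift since the constant terms cancel.\<close>

definition varsigma_quot :: "complex \<Rightarrow> complex fps" where
  "varsigma_quot c = fps_shift 1 (fps_exp (c / 2) - fps_exp (- c / 2))"

lemma varsigma_eq: "varsigma c = fps_to_fls (fps_X * varsigma_quot c)"
  unfolding varsigma_def varsigma_quot_def by (intro arg_cong[of _ _ fps_to_fls] fps_ext) simp

lemma varsigma_quot_0: "fps_nth (varsigma_quot c) 0 = c"
  by (simp add: varsigma_quot_def)

text \<open>Each of the N factors contributes one \<open>u\<close> and the prefactor takes one back,
  leaving order N - 1. The normalised factors all start with 1, so the leading coefficient is 1 /
  N!.\<close>

lemma E_weight_eq:
  assumes "0 \<notin> set js" "js \<noteq> []"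
  obtains h where "fps_nth h 0 = 1 / fact (length js)"
    "E_weight js = fps_to_fls (fps_X ^ (length js - 1) * h)"
proof -
  define t where "t j = varsigma_quot (of_int j) * fps_const (1 / of_int j)" for j :: int
  have prod: "(\<Prod>j\<leftarrow>js. varsigma (of_int j) * fls_const (1 / of_int j))
      = fps_to_fls (fps_X ^ length js * (\<Prod>j\<leftarrow>js. t j))" for js
    by (induction js) (simp_all add: varsigma_eq t_def fls_times_fps_to_fls fps_to_fls_power algebra_simps)
  have prod0: "fps_nth (\<Prod>j\<leftarrow>js. t j) 0 = 1"
    using assms(1) by (induction js) (simp_all add: t_def varsigma_quot_0)
  have nz: "varsigma 1 \<noteq> 0"
    using varsigma_quot_0[of 1] unfolding varsigma_eq by (auto simp: fls_times_fps_to_fls)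
  define s where "s = varsigma_quot 1"
  have s0: "fps_nth s 0 \<noteq> 0" by (simp add: s_def varsigma_quot_0)
  define h where "h = fps_const (1 / fact (length js)) * (\<Prod>j\<leftarrow>js. t j) * inverse s"
  have h0: "fps_nth h 0 = 1 / fact (length js)"
    by (simp add: h_def prod0 s_def varsigma_quot_0)
  have X: "fps_X ^ (length js - 1) * fps_X = (fps_X :: complex fps) ^ length js"
    using assms(2) by (cases js) (simp_all add: power_Suc2 del: power_Suc)
  have "fps_X ^ (length js - 1) * h * (fps_X * s) = fps_X ^ length js * (fps_const (1 / fact (length js)) * (\<Prod>j\<leftarrow>js. t j)) * (inverse s * s)"
    unfolding h_def X[symmetric] by (simp only: ac_simps)
  also have "inverse s * s = 1" using s0 by (rule inverse_mult_eq_1)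
  finally have "fps_to_fls (fps_X ^ (length js - 1) * h) * varsigma 1
      = fls_const (1 / fact (length js)) * fps_to_fls (fps_X ^ length js * (\<Prod>j\<leftarrow>js. t j))"
    by (simp add: varsigma_eq s_def ac_simps flip: fls_times_fps_to_fls fps_const_to_fls)
  also have "\<dots> = E_weight js * varsigma 1"
    using nz by (simp add: E_weight_def prod)
  finally show ?thesis using nz h0 by (intro that[of h]) auto
qed

lemma E_weight_nth_below:
  assumes "0 \<notin> set js" "r + 1 < length js"
  shows "fls_nth (E_weight js) (int r) = 0"
proof -
  obtain h where "E_weight js = fps_to_fls (fps_X ^ (length js - 1) * h)"
    using E_weight_eq[OF assms(1)] assms(2) by (metis list.size(3) not_less_zero)
  then show ?thesis using assms(2) by (simp add: fps_X_power_mult_nth)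
qed

lemma E_weight_nth_lead:
  assumes "0 \<notin> set js" "length js = r + 1"
  shows "fls_nth (E_weight js) (int r) = 1 / fact (r + 1)"
proof -
  obtain h where "fps_nth h 0 = 1 / fact (length js)" "E_weight js = fps_to_fls (fps_X ^ (length js - 1) * h)"
    using E_weight_eq[OF assms(1)] assms(2) by (metis Suc_eq_plus1 Zero_neq_Suc list.size(3))
  then show ?thesis using assms(2) by (simp add: fps_X_power_mult_nth)
qed

section \<open>Terms with exactly one creation operator\<close>

definition pos_lists :: "nat \<Rightarrow> int list set" where
  "pos_lists r = {is. length is = r \<and> (\<forall>i\<in>set is. i > 0)}"

text \<open>All indices must add up to \<open>- k\<close>, so the annihilation indices
  \<open>is\<close> determine the single creation operator.\<close>

definition lead :: "nat \<Rightarrow> int list \<Rightarrow> fock_op" where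
  "lead k is f = J (- (int k + sum_list is)) (J_prod is f)"

text \<open>
  The lists of length \<open>r + 1\<close> and sum \<open>-k\<close> with one negative entry are the values of \<open>insert_neg k (t, is)\<close>
  for \<open>is\<close> positive of length \<open>r\<close>. The \<open>r + 1\<close> positions \<open>t\<close> of that entry have the same normal ordering, which
  cancels the weight \<open>r! / (r + 1)!\<close>.
\<close>

definition insert_neg :: "nat \<Rightarrow> nat \<times> int list \<Rightarrow> int list" where
  "insert_neg k = (\<lambda>(t, is). take t is @ (- (int k + sum_list is)) # drop t is)"

lemma sum_list_pos: "\<forall>i\<in>set is. i > 0 \<Longrightarrow> sum_list is \<ge> (0::int)"
  by (rule sum_list_nonneg) auto

lemma filter_insert_neg:
  assumes "k > 0" "is \<in> pos_lists r"
  shows "filter (\<lambda>j. j < 0) (insert_neg k (t, is)) = [- (int k + sum_list is)]"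
    and "filter (\<lambda>j. \<not> j < 0) (insert_neg k (t, is)) = is"
proof -
  have pos: "\<And>i. i \<in> set (take t is) \<or> i \<in> set (drop t is) \<Longrightarrow> \<not> i < 0"
    using assms(2) by (force simp: pos_lists_def dest: in_set_takeD in_set_dropD)
  have "sum_list is \<ge> 0" using assms(2) by (auto simp: pos_lists_def intro: sum_list_pos)
  then have neg: "- (int k + sum_list is) < 0" using assms(1) by simp
  show "filter (\<lambda>j. j < 0) (insert_neg k (t, is)) = [- (int k + sum_list is)]"
    using pos neg by (simp add: insert_neg_def filter_empty_conv)
  have "filter (\<lambda>j. \<not> j < 0) (insert_neg k (t, is)) = take t is @ drop t is"
    using pos neg unfolding insert_neg_def prod.case filter_append filter.simps
    by (metis (mono_tags, lifting) filter_True)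
  then show "filter (\<lambda>j. \<not> j < 0) (insert_neg k (t, is)) = is" by simp
qed

lemma normal_ordered_insert_neg:
  assumes "k > 0" "is \<in> pos_lists r"
  shows "normal_ordered (insert_neg k (t, is)) f = lead k is f"
  by (simp only: normal_ordered_eq filter_insert_neg[OF assms] lead_def J_prod_Cons J_prod_Nil)

lemma inj_insert_neg:
  assumes "k > 0"
  shows "inj_on (insert_neg k) ({..r} \<times> pos_lists r)"
\<comment> \<open>The inverse finds the position as the length of the prefix before the negative
  entry.\<close>
proof (rule inj_on_inverseI[where g = "\<lambda>js. (length (takeWhile (\<lambda>j. \<not> j < 0) js), filter (\<lambda>j. \<not> j < 0) js)"])
  fix x assume "x \<in> {..r} \<times> pos_lists r"
  then obtain t "is" where x: "x = (t, is)" and t: "t \<le> r" and p: "is \<in> pos_lists r" by auto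
  have pos: "\<And>i. i \<in> set (take t is) \<Longrightarrow> \<not> i < 0"
    using p by (force simp: pos_lists_def dest: in_set_takeD)
  have "sum_list is \<ge> 0" using p by (auto simp: pos_lists_def intro: sum_list_pos)
  then have "- (int k + sum_list is) < 0" using assms by simp
  then have "takeWhile (\<lambda>j. \<not> j < 0) (insert_neg k (t, is)) = take t is"
    using pos by (simp add: insert_neg_def takeWhile_append2)
  then show "(length (takeWhile (\<lambda>j. \<not> j < 0) (insert_neg k x)), filter (\<lambda>j. \<not> j < 0) (insert_neg k x)) = x"
    using t p filter_insert_neg(2)[OF assms p] by (simp add: x pos_lists_def)
qed

text \<open>A negative index sum forces c \<ge> 1 creation operators, and the weight forces N \<le>
  r + 1 factors. The degree change \<open>2 * c - N\<close> then equals \<open>1 - r\<close> if c =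
  1 and N = r + 1, and is at least \<open>2 - r\<close> otherwise. \<open>S\<close> may exceed the
  support of \<open>f\<close>, so that one set can serve several polynomials.\<close>

lemma F_op_lead:
  assumes k: "k > 0" and d: "mdeg_ge d f" and S: "finite S" "S \<subseteq> pos_lists r"
    and supp: "\<And>is. is \<in> pos_lists r \<Longrightarrow> J_prod is f \<noteq> 0 \<Longrightarrow> is \<in> S"
  shows "mdeg_ge (d - int r + 2) (F_op k r f - (\<Sum>is\<in>S. lead k is f))"
proof -
  let ?E = "E_support (- int k) f"
  let ?neg = "\<lambda>js. length (filter (\<lambda>j. j < 0) js)"
  define L where "L = {js\<in>?E. length js = r + 1 \<and> ?neg js = 1}"
  let ?w = "\<lambda>js. fls_nth (E_weight js) (int r)"
  let ?T = "\<lambda>js. const (?w js) * normal_ordered js f"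
  have fin: "finite ?E" by (rule finite_E_support)
  have LE: "L \<subseteq> ?E" by (auto simp: L_def)
  have rest: "mdeg_ge (d - int r + 2) (?T js)" if js: "js \<in> ?E - L" for js
  proof -
    have z: "0 \<notin> set js" and s: "sum_list js = - int k" using js by (auto simp: E_support_def)
    have "filter (\<lambda>j. j < 0) js \<noteq> []"
    proof
      assume "filter (\<lambda>j. j < 0) js = []"
      then have "sum_list js \<ge> 0" by (intro sum_list_nonneg) (auto simp: filter_empty_conv)
      then show False using s k by simp
    qed
    then have neg: "?neg js \<ge> 1" by (cases "filter (\<lambda>j. j < 0) js") auto
    show ?thesis
    proof (cases "r + 1 < length js")
      case True
      then show ?thesis using E_weight_nth_below[OF z True] by simp
    next
      case False
      then have "d - int r + 2 \<le> d - int (length js) + 2 * int (?neg js)"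
        using neg js by (cases "?neg js = 1") (auto simp: L_def)
      then show ?thesis
        by (intro mdeg_ge_const_mult mdeg_ge_mono[OF mdeg_ge_normal_ordered[OF d z]])
    qed
  qed
  have L_image: "L \<subseteq> insert_neg k ` ({..r} \<times> S)"
  proof
    fix js assume js: "js \<in> L"
    then have z: "0 \<notin> set js" and s: "sum_list js = - int k" and nz: "normal_ordered js f \<noteq> 0"
      and len: "length js = r + 1" and "?neg js = 1"
      by (auto simp: L_def E_support_def)
    then obtain x where "filter (\<lambda>j. j < 0) js = [x]"
      by (metis One_nat_def length_0_conv length_Suc_conv)
    then obtain u v where uv: "js = u @ x # v" "\<forall>j\<in>set u. \<not> j < 0" "x < 0" "filter (\<lambda>j. j < 0) v = []"
      by (auto simp: filter_eq_Cons_iff)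
    have pos: "\<forall>i\<in>set (u @ v). i > 0"
      using uv z by (force simp: filter_empty_conv not_less order.order_iff_strict)
    have P: "u @ v \<in> pos_lists r" using pos len uv(1) by (simp add: pos_lists_def)
    have eq: "js = insert_neg k (length u, u @ v)"
      using s uv(1) by (simp add: insert_neg_def)
    have "lead k (u @ v) f \<noteq> 0"
      using nz normal_ordered_insert_neg[OF k P, of "length u" f] eq by simp
    then have "u @ v \<in> S" using supp[OF P] by (metis J_0 lead_def)
    moreover have "length u \<le> r" using len uv(1) by simp
    ultimately show "js \<in> insert_neg k ` ({..r} \<times> S)" using eq by blast
  qed
  have inj: "inj_on (insert_neg k) ({..r} \<times> S)"
    by (rule inj_on_subset[OF inj_insert_neg[OF k, of r]]) (use S in auto)
  have sum_L: "(\<Sum>js\<in>L. normal_ordered js f) = of_nat (r + 1) * (\<Sum>is\<in>S. lead k is f)"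
  proof -
    \<comment> \<open>Lists in the image meet every condition of \<open>L\<close> except perhaps
      nonvanishing on \<open>f\<close>, so the added terms are 0.\<close>
    have "(\<Sum>js\<in>L. normal_ordered js f) = (\<Sum>js\<in>insert_neg k ` ({..r} \<times> S). normal_ordered js f)"
    proof (rule sum.mono_neutral_left)
      show "\<forall>js\<in>insert_neg k ` ({..r} \<times> S) - L. normal_ordered js f = 0"
      proof
        fix js assume js: "js \<in> insert_neg k ` ({..r} \<times> S) - L"
        then obtain t "is" where t: "js = insert_neg k (t, is)" "t \<le> r" and P: "is \<in> pos_lists r" using S by auto
        have "int k + sum_list is > 0" using P sum_list_pos[of "is"] k by (auto simp: pos_lists_def)
        then have z: "0 \<notin> set js" using P
          by (auto simp: t insert_neg_def pos_lists_def dest: in_set_takeD in_set_dropD)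
        have "sum_list (take t is) + sum_list (drop t is) = sum_list is"
          by (metis append_take_drop_id sum_list_append)
        then have "sum_list js = - int k" by (simp add: t insert_neg_def)
        moreover have "length js = r + 1" using t P by (simp add: insert_neg_def pos_lists_def)
        moreover have "?neg js = 1" using filter_insert_neg(1)[OF k P] by (simp add: t)
        ultimately show "normal_ordered js f = 0" using js z by (auto simp: L_def E_support_def)
      qed
    qed (use S L_image in auto)
    also have "\<dots> = (\<Sum>x\<in>{..r} \<times> S. normal_ordered (insert_neg k x) f)"
      by (simp add: sum.reindex[OF inj])
    also have "\<dots> = (\<Sum>x\<in>{..r} \<times> S. lead k (snd x) f)"
      using S normal_ordered_insert_neg[OF k] by (intro sum.cong) auto
    also have "\<dots> = (\<Sum>t\<in>{..r}. \<Sum>is\<in>S. lead k is f)"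
      by (simp only: sum.cartesian_product case_prod_unfold)
    finally show ?thesis by simp
  qed
  have "const (fact r) * (\<Sum>js\<in>L. ?T js) = const (fact r) * (const (1 / fact (r + 1)) * (\<Sum>js\<in>L. normal_ordered js f))"
    unfolding sum_distrib_left
    by (intro sum.cong refl) (auto simp: L_def E_support_def E_weight_nth_lead)
  also have "\<dots> = const (fact r * (1 / fact (r + 1)) * of_nat (r + 1)) * (\<Sum>is\<in>S. lead k is f)"
    unfolding sum_L by (simp only: const_mult const_of_nat mult.assoc)
  also have "fact r * (1 / fact (r + 1)) * of_nat (r + 1) = (1::complex)"
    by (simp del: of_nat_Suc)
  finally have main: "const (fact r) * (\<Sum>js\<in>L. ?T js) = (\<Sum>is\<in>S. lead k is f)"
    by simp
  have "F_op k r f = const (fact r) * ((\<Sum>js\<in>?E - L. ?T js) + (\<Sum>js\<in>L. ?T js))"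
    by (simp only: F_op_def E_coeff_def scal_def sum.subset_diff[OF LE fin])
  then have eq: "F_op k r f - (\<Sum>is\<in>S. lead k is f) = const (fact r) * (\<Sum>js\<in>?E - L. ?T js)"
    by (simp only: distrib_left main) simp
  show ?thesis
    unfolding eq by (rule mdeg_ge_const_mult, rule mdeg_ge_sum, rule rest)
qed

section \<open>Iterating the leading part\<close>

lemma lead_add: "lead k is (f + g) = lead k is f + lead k is g"
  by (simp add: lead_def J_prod_add J_add)

lemma lead_const_mult: "lead k is (const c * f) = const c * lead k is f"
  by (simp add: lead_def J_prod_const_mult J_const_mult)

lemma mdeg_ge_lead:
  assumes "k > 0" "is \<in> pos_lists r" "mdeg_ge d f"
  shows "mdeg_ge (d - int r + 1) (lead k is f)"
proof -
  have "int k + sum_list is > 0" using assms sum_list_pos[of "is"] by (auto simp: pos_lists_def)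
  then show ?thesis
    using mdeg_ge_J_neg[OF mdeg_ge_J_prod_pos[OF assms(3)], of "is" "- (int k + sum_list is)"] assms(2)
    by (simp add: lead_def pos_lists_def)
qed

text \<open>Annihilation indices adding up to more than the weighted degree of \<open>f\<close> kill
  it.\<close>

lemma finite_J_prod_support: "finite {is \<in> pos_lists r. J_prod is f \<noteq> 0}"
proof -
  define D where "D = (\<Sum>a\<in>Poly_Mapping.keys f. wdeg a)"
  have D: "wdeg_le D f"
    unfolding wdeg_le_def D_def by (auto intro!: member_le_sum wdeg_nonneg)
  have "set is \<subseteq> {0..D} \<and> length is = r" if "is": "is \<in> pos_lists r" "J_prod is f \<noteq> 0" for "is"
  proof -
    have pos: "\<forall>i\<in>set is. i > 0" and len: "length is = r" using "is" by (auto simp: pos_lists_def)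
    have "sum_list is \<le> D"
      using wdeg_le_neg[OF wdeg_le_op_prod[OF pos D]] "is"(2) unfolding J_prod_def
      by (meson diff_less_0_iff_less not_le)
    moreover have "i \<le> sum_list is" if "i \<in> set is" for i
      using pos that by (intro member_le_sum_list) (auto simp: less_imp_le)
    ultimately show ?thesis using pos len by (force intro: less_imp_le)
  qed
  then have "{is \<in> pos_lists r. J_prod is f \<noteq> 0} \<subseteq> {is. set is \<subseteq> {0..D} \<and> length is = r}" by blast
  then show ?thesis by (rule finite_subset) (simp add: finite_lists_length_eq)
qed

section \<open>Annihilation operators on series in the flow parameter \<open>s\<close>\<close>

definition fps_J :: "int \<Rightarrow> fock fps \<Rightarrow> fock fps" where
  "fps_J i f = Abs_fps (\<lambda>n. J i (fps_nth f n))"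

lemma fps_J_nth [simp]: "fps_nth (fps_J i f) n = J i (fps_nth f n)"
  by (simp add: fps_J_def)

lemma fps_J_mult: "i > 0 \<Longrightarrow> fps_J i (f * g) = fps_J i f * g + f * fps_J i g"
  by (rule fps_ext) (simp add: fps_mult_nth J_sum J_mult sum.distrib)

lemma fps_J_1 [simp]: "i > 0 \<Longrightarrow> fps_J i 1 = 0"
  using J_const[of i 1] J_const[of i 0] by (intro fps_ext) (auto simp: fps_one_nth)

lemma fps_J_const_mult: "fps_J i (fps_const (const c) * f) = fps_const (const c) * fps_J i f"
  by (rule fps_ext) (simp add: J_const_mult)

definition F_scaled :: "nat \<Rightarrow> nat \<Rightarrow> fock_op" where
  "F_scaled k r f = scal (1 / of_nat r) (F_op k r f)"

text \<open>The order in \<open>s\<close> of a variable is encoded in its index: by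
  \<open>e_step\<close>, annihilating variables of orders \<open>js\<close> creates one of order
  \<open>Suc (sum_list js)\<close>. \<open>phi_rec\<close> is the flow equation for
  \<open>P\<close>, read off at each created variable.\<close>

locale tree_flow =
  fixes k r :: nat and e :: "nat \<Rightarrow> nat" and \<phi> :: "nat \<Rightarrow> complex"
  assumes k: "k > 0" and r: "r > 0"
    and e_pos: "\<And>j. e j > 0" and e_inj: "inj e"
    and e_step: "\<And>js. length js = r \<Longrightarrow> k + sum_list (map e js) = e (Suc (sum_list js))"
    and phi_rec: "\<And>n. of_nat r * of_nat (Suc n) * \<phi> (Suc n) = fps_nth (Abs_fps (\<lambda>j. of_nat (e j) * \<phi> j) ^ r) n"
begin

text \<open>
  The power \<open>P ^ d\<close>, divided by \<open>d!\<close>, is the part of degree \<open>d\<close> of the exponential \<open>exp P\<close> preserved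
  by the flow. Working degree by degree avoids infinite series of polynomials.
\<close>

definition P :: "fock fps" where
  "P = Abs_fps (\<lambda>j. const (\<phi> j) * p_var (e j))"

text \<open>The derivative \<open>J i\<close> of \<open>P\<close>, a series with scalar coefficients
  because \<open>P\<close> is linear in the variables.\<close>

definition DP :: "int \<Rightarrow> fock fps" where
  "DP i = Abs_fps (\<lambda>j. if i = int (e j) then const (of_nat (e j) * \<phi> j) else 0)"

lemma fps_J_P: "i > 0 \<Longrightarrow> fps_J i P = DP i"
  by (rule fps_ext)
    (simp add: P_def DP_def J_const_mult J_p_var e_pos mult_single mult.commute[of "\<phi> _"] del: single_of_int single_of_nat)

lemma fps_J_DP [simp]: "i > 0 \<Longrightarrow> fps_J i (DP j) = 0"
  by (rule fps_ext) (simp add: DP_def)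

lemma fps_J_prod_DP [simp]: "i > 0 \<Longrightarrow> fps_J i (prod_list (map DP js)) = 0"
  by (induction js) (simp_all add: fps_J_mult)

lemma fps_J_P_power: "i > 0 \<Longrightarrow> fps_J i (P ^ Suc d) = of_nat (Suc d) * DP i * P ^ d"
proof (induction d)
  case (Suc d)
  have "fps_J i (P ^ Suc (Suc d)) = DP i * P ^ Suc d + P * (of_nat (Suc d) * DP i * P ^ d)"
    using Suc by (subst power_Suc) (simp only: fps_J_mult fps_J_P Suc.IH)
  also have "\<dots> = of_nat (Suc (Suc d)) * DP i * P ^ Suc d"
    by (simp add: algebra_simps)
  finally show ?case .
qed (simp add: fps_J_P)

text \<open>Each \<open>DP i\<close> is free of variables, so every operator acts only on the power
  of \<open>P\<close>; the exponents brought down form a falling factorial.\<close>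

lemma J_prod_P_power:
  assumes "\<forall>i\<in>set is. i > 0"
  shows "Abs_fps (\<lambda>n. J_prod is (fps_nth (P ^ (length is + d)) n)) =
           fps_const (const (fact (length is + d) / fact d)) * (prod_list (map DP is) * P ^ d)"
  using assms
proof (induction "is" arbitrary: d)
  case Nil
  show ?case by (rule fps_ext) simp
next
  case (Cons i "is")
  let ?N = "length is"
  have i: "i > 0" using Cons.prems by simp
  have c: "fact (?N + Suc d) / fact (Suc d) * of_nat (Suc d) = (fact (length (i # is) + d) / fact d :: complex)"
    by (simp del: of_nat_Suc)
  have "Abs_fps (\<lambda>n. J_prod (i # is) (fps_nth (P ^ (length (i # is) + d)) n))
      = fps_J i (Abs_fps (\<lambda>n. J_prod is (fps_nth (P ^ (?N + Suc d)) n)))"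
    by (rule fps_ext) simp
  also have "\<dots> = fps_J i (fps_const (const (fact (?N + Suc d) / fact (Suc d))) * (prod_list (map DP is) * P ^ Suc d))"
    using Cons.IH[of "Suc d"] Cons.prems by simp
  also have "\<dots> = fps_const (const (fact (?N + Suc d) / fact (Suc d))) * (prod_list (map DP is) * (of_nat (Suc d) * DP i * P ^ d))"
    using i by (simp only: fps_J_const_mult fps_J_mult fps_J_prod_DP fps_J_P_power) simp
  also have "\<dots> = (fps_const (const (fact (?N + Suc d) / fact (Suc d))) * of_nat (Suc d)) * (prod_list (map DP (i # is)) * P ^ d)"
    by (simp add: mult_ac del: of_nat_Suc)
  also have "fps_const (const (fact (?N + Suc d) / fact (Suc d))) * of_nat (Suc d) = fps_const (const (fact (length (i # is) + d) / fact d))"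
    unfolding c[symmetric] by (simp only: const_mult const_of_nat fps_of_nat[symmetric] fps_const_mult)
  finally show ?case .
qed

lemma prod_DP:
  "prod_list (map DP (map (\<lambda>j. int (e j)) js)) =
     fps_const (const (\<Prod>j\<leftarrow>js. of_nat (e j) * \<phi> j)) * fps_X ^ sum_list js"
proof (induction js)
  case (Cons j js)
  have "DP (int (e j)) = fps_const (const (of_nat (e j) * \<phi> j)) * fps_X ^ j"
    using injD[OF e_inj] by (intro fps_ext) (auto simp: DP_def fps_X_power_iff)
  then show ?case using Cons
    by (simp add: const_mult power_add mult_ac flip: fps_const_mult del: single_of_nat)
qed simp

lemma prod_DP_eq_0:
  assumes "i \<in> set is" "i \<notin> range (\<lambda>j. int (e j))"
  shows "prod_list (map DP is) = 0"
proof -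
  have "DP i = 0" using assms(2) by (intro fps_ext) (auto simp: DP_def)
  then show ?thesis using assms(1) by (induction "is") auto
qed

text \<open>One step of the flow: the leading part sends \<open>P ^ (r + d) / (r + d)!\<close> to
  \<open>r\<close> times the \<open>s\<close>-derivative of \<open>P ^ (d + 1) / (d + 1)!\<close>.
  Annihilation leaves \<open>P ^ d / d!\<close>, and the created variables assemble into
  \<open>r\<close> times the derivative of \<open>P\<close>.\<close>

lemma sum_lead_P_power:
  assumes S: "finite S" "S \<subseteq> pos_lists r"
    and sub: "\<And>js n. js \<in> natpermute n r \<Longrightarrow> n \<le> b \<Longrightarrow> map (\<lambda>j. int (e j)) js \<in> S"
  shows "(\<Sum>is\<in>S. lead k is (fps_nth (P ^ (r + d)) b)) =
     const (of_nat r * of_nat (Suc b) * fact (r + d) / fact (Suc d)) * fps_nth (P ^ Suc d) (Suc b)"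
proof -
  let ?m = "map (\<lambda>j. int (e j))"
  let ?C = "const (fact (r + d) / fact d)"
  let ?K = "\<lambda>js. const (\<Prod>j\<leftarrow>js. of_nat (e j) * \<phi> j)"
  define N where "N = (\<Union>n\<in>{..b}. natpermute n r)"
  have fin: "finite (natpermute n r)" for n by (rule natpermute_finite)
  have inj: "inj_on ?m N"
    using e_inj by (auto intro!: inj_on_mapI simp: inj_on_def)
  have val: "lead k is (fps_nth (P ^ (r + d)) b) =
      J (- (int k + sum_list is)) (?C * fps_nth (prod_list (map DP is) * P ^ d) b)" if "is \<in> S" for "is"
  proof -
    have "is": "length is = r" "\<forall>i\<in>set is. i > 0" using that S by (auto simp: pos_lists_def)
    show ?thesis
      using arg_cong[OF J_prod_P_power[OF "is"(2), of d], of "\<lambda>f. fps_nth f b"] "is"(1)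
      by (simp add: lead_def)
  qed
  \<comment> \<open>Either some index lies outside the range of \<open>e\<close> and its
    \<open>DP\<close> vanishes, or the orders add up to more than \<open>b\<close>.\<close>
  have zero: "lead k is (fps_nth (P ^ (r + d)) b) = 0" if "is": "is \<in> S - ?m ` N" for "is"
  proof (cases "set is \<subseteq> range (\<lambda>j. int (e j))")
    case True
    then obtain js where js: "is = ?m js"
      by (metis ex_map_conv subsetD rangeE)
    have "length js = r" using "is" S by (auto simp: js pos_lists_def)
    then have "b < sum_list js" using "is" by (force simp: js N_def natpermute_def not_le[symmetric])
    moreover have "prod_list (map DP is) = fps_const (?K js) * fps_X ^ sum_list js"
      unfolding js by (rule prod_DP)
    ultimately show ?thesis using "is" val[of "is"]
      by (simp add: mult.assoc fps_X_power_mult_nth)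
  next
    case False
    then show ?thesis using "is" val[of "is"] prod_DP_eq_0[of _ "is"] by auto
  qed
  have lead_eq: "lead k (?m js) (fps_nth (P ^ (r + d)) b) =
      ?C * (p_var (e (Suc n)) * ?K js * fps_nth (P ^ d) (b - n))" if js: "js \<in> natpermute n r" and n: "n \<le> b" for js n
  proof -
    have len: "length js = r" and sum: "sum_list js = n" using js by (auto simp: natpermute_def)
    \<comment> \<open>The created variable depends on \<open>js\<close> only through the total order
      \<open>n\<close>, so the sum over \<open>js\<close> can be taken on the scalars alone.\<close>
    have "int k + sum_list (?m js) = int (e (Suc n))"
      unfolding sum[symmetric] e_step[OF len, symmetric] by (induction js) simp_all
    then show ?thesis
      using val[OF sub[OF js n]] e_pos[of "Suc n"] n
      by (simp only: prod_DP sum) (simp add: J_def mult.assoc fps_X_power_mult_nth mult_ac)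
  qed
  \<comment> \<open>The sum over compositions is a coefficient of an \<open>r\<close>-th power, to
    which \<open>phi_rec\<close> applies. \<open>fps_power_nth\<close> indexes the factors up to
    \<open>r - 1\<close>, hence the appeal to \<open>r > 0\<close>.\<close>
  have K: "(\<Sum>js\<in>natpermute n r. ?K js) = const (of_nat r * of_nat (Suc n) * \<phi> (Suc n))" for n
  proof -
    have "(\<Prod>j\<leftarrow>js. of_nat (e j) * \<phi> j) = (\<Prod>i\<in>{0..r - 1}. of_nat (e (js ! i)) * \<phi> (js ! i))"
      if "js \<in> natpermute n r" for js
    proof -
      have "{0..r - 1} = {0..<r}" using r by auto
      then show ?thesis using that by (auto simp: prod.list_conv_set_nth natpermute_def intro!: prod.cong)
    qed
    then show ?thesis
      using r unfolding phi_rec by (subst fps_power_nth) (simp add: const_sum)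
  qed
  have deriv: "of_nat (Suc d) * fps_nth (P ^ d * fps_deriv P) b = of_nat (Suc b) * fps_nth (P ^ Suc d) (Suc b)"
  proof -
    have "fps_deriv (P ^ Suc d) = fps_const (of_nat (Suc d)) * (P ^ d * fps_deriv P)"
      by (simp only: fps_deriv_power diff_Suc_1 mult_ac)
    then have "fps_nth (fps_deriv (P ^ Suc d)) b = of_nat (Suc d) * fps_nth (P ^ d * fps_deriv P) b"
      by (simp only: fps_mult_left_const_nth)
    then show ?thesis by (simp only: fps_deriv_nth Suc_eq_plus1)
  qed
  have "(\<Sum>is\<in>S. lead k is (fps_nth (P ^ (r + d)) b)) = (\<Sum>is\<in>?m ` N. lead k is (fps_nth (P ^ (r + d)) b))"
    using S(1) sub zero by (intro sum.mono_neutral_right) (auto simp: N_def)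
  also have "\<dots> = (\<Sum>js\<in>N. lead k (?m js) (fps_nth (P ^ (r + d)) b))"
    by (simp add: sum.reindex[OF inj])
  also have "\<dots> = (\<Sum>n\<le>b. \<Sum>js\<in>natpermute n r. lead k (?m js) (fps_nth (P ^ (r + d)) b))"
    unfolding N_def by (intro sum.UNION_disjoint) (auto simp: fin, auto simp: natpermute_def)
  also have "\<dots> = (\<Sum>n\<le>b. \<Sum>js\<in>natpermute n r. ?C * (p_var (e (Suc n)) * ?K js * fps_nth (P ^ d) (b - n)))"
    by (intro sum.cong refl) (simp add: lead_eq)
  also have "\<dots> = (\<Sum>n\<le>b. ?C * (p_var (e (Suc n)) * (\<Sum>js\<in>natpermute n r. ?K js) * fps_nth (P ^ d) (b - n)))"
    by (simp only: sum_distrib_left sum_distrib_right)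
  \<comment> \<open>The coefficient of \<open>fps_deriv P\<close> at \<open>n\<close> is
    \<open>Suc n * \<phi> (Suc n)\<close> times the variable of index
    \<open>e (Suc n)\<close>.\<close>
  also have "\<dots> = ?C * of_nat r * (\<Sum>n\<le>b. fps_nth (fps_deriv P) n * fps_nth (P ^ d) (b - n))"
    unfolding K sum_distrib_left
    by (intro sum.cong refl) (simp add: const_mult P_def mult_ac del: of_nat_Suc)
  also have "\<dots> = ?C * of_nat r * fps_nth (P ^ d * fps_deriv P) b"
    by (subst mult.commute[of "P ^ d"]) (simp add: fps_mult_nth atLeast0AtMost)
  also have "?C = const (fact (r + d) / fact (Suc d)) * of_nat (Suc d)"
    unfolding const_of_nat[symmetric] const_mult[symmetric] by (simp del: of_nat_Suc)
  also have "\<dots> * of_nat r * fps_nth (P ^ d * fps_deriv P) b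
      = const (fact (r + d) / fact (Suc d)) * of_nat r * (of_nat (Suc d) * fps_nth (P ^ d * fps_deriv P) b)"
    by (simp only: mult_ac)
  also have "\<dots> = const (of_nat r * of_nat (Suc b) * (fact (r + d) / fact (Suc d))) * fps_nth (P ^ Suc d) (Suc b)"
    unfolding deriv by (simp only: const_mult const_of_nat mult_ac)
  finally show ?thesis by simp
qed

lemma mdeg_ge_P_power: "mdeg_ge (int d) (fps_nth (P ^ d) b)"
proof (induction d arbitrary: b)
  case 0
  have "mdeg_ge 0 (const (if b = 0 then 1 else 0))" by (rule mdeg_ge_const)
  then show ?case by (cases "b = 0") simp_all
next
  case (Suc d)
  have P: "mdeg_ge 1 (fps_nth P n)" for n
    by (simp add: P_def mdeg_ge_const_mult)
  show ?case
    using mdeg_ge_mult[OF P Suc] by (simp add: fps_mult_nth) (auto intro!: mdeg_ge_sum)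
qed

text \<open>Each step lowers degrees by at most \<open>r - 1\<close>, and the lowest part follows
  the flow; terms above it stay above it. Hence the induction hypothesis is used with
  \<open>d + (r - 1)\<close>. The flow's factor \<open>r\<close> cancels the scaling.\<close>

lemma F_scaled_power:
  assumes "(r - 1) * b + Suc d = l" "\<phi> 0 = 1"
  shows "mdeg_ge (int d + 2) ((F_scaled k r ^^ b) (p_var (e 0) ^ l) - const (fact b * fact l / fact (Suc d)) * fps_nth (P ^ Suc d) b)"
  using assms(1)
proof (induction b arbitrary: d)
  case 0
  have "fps_nth (P ^ n) 0 = p_var (e 0) ^ n" for n
    by (simp add: P_def assms(2) fps_nth_power_0)
  then show ?case using 0 by simp
next
  case (Suc b)
  define f where "f = (F_scaled k r ^^ b) (p_var (e 0) ^ l)"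
  define Q where "Q = const (fact b * fact l / fact (r + d)) * fps_nth (P ^ (r + d)) b"
  define h where "h = f - Q"
  have rd: "r + d = Suc (d + (r - 1))" using r by simp
  have h: "mdeg_ge (int (r + d) + 1) h"
  proof -
    have "(r - 1) * b + Suc (d + (r - 1)) = l"
      using Suc.prems unfolding mult_Suc_right by linarith
    from Suc.IH[OF this] have "mdeg_ge (int (d + (r - 1)) + 2) h"
      by (simp only: h_def f_def Q_def rd)
    moreover have "int (d + (r - 1)) + 2 = int (r + d) + 1" using rd by linarith
    ultimately show ?thesis by metis
  qed
  have fQ: "f = Q + h" by (simp add: h_def)
  have f: "mdeg_ge (int (r + d)) f"
    unfolding fQ Q_def using h
    by (intro mdeg_ge_add mdeg_ge_const_mult mdeg_ge_P_power) (auto intro: mdeg_ge_mono)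
  \<comment> \<open>The first set covers all leading terms of \<open>f\<close>, the second those
    needed for the power of \<open>P\<close>.\<close>
  define S where "S = {is \<in> pos_lists r. J_prod is f \<noteq> 0} \<union> map (\<lambda>j. int (e j)) ` (\<Union>n\<in>{..b}. natpermute n r)"
  have S: "finite S" "S \<subseteq> pos_lists r"
    using finite_J_prod_support[of r f] natpermute_finite[of _ r] e_pos
    by (auto simp: S_def pos_lists_def natpermute_def)
  let ?L = "\<lambda>f. \<Sum>is\<in>S. lead k is f"
  have 1: "mdeg_ge (int d + 2) (F_op k r f - ?L f)"
    using F_op_lead[OF k f S] by (auto simp: S_def)
  have 2: "mdeg_ge (int d + 2) (?L h)"
  proof (rule mdeg_ge_sum)
    fix "is" assume "is \<in> S"
    then have "mdeg_ge (int (r + d) + 1 - int r + 1) (lead k is h)"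
      using S(2) by (intro mdeg_ge_lead[OF k _ h]) auto
    then show "mdeg_ge (int d + 2) (lead k is h)" by (simp add: add.commute)
  qed
  have "?L (fps_nth (P ^ (r + d)) b) = const (of_nat r * of_nat (Suc b) * fact (r + d) / fact (Suc d)) * fps_nth (P ^ Suc d) (Suc b)"
    using S by (rule sum_lead_P_power) (auto simp: S_def)
  then have LQ: "?L Q = const (fact b * fact l / fact (r + d) * (of_nat r * of_nat (Suc b) * fact (r + d) / fact (Suc d))) * fps_nth (P ^ Suc d) (Suc b)"
    unfolding Q_def lead_const_mult sum_distrib_left[symmetric] by (simp only: const_mult mult.assoc)
  have "F_op k r f = ?L Q + (F_op k r f - ?L f + ?L h)"
    by (simp add: fQ lead_add sum.distrib)
  then have "F_scaled k r f = const (1 / of_nat r) * ?L Q + const (1 / of_nat r) * (F_op k r f - ?L f + ?L h)"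
    unfolding F_scaled_def scal_def by (metis distrib_left)
  also have "const (1 / of_nat r) * ?L Q
      = const (1 / of_nat r * (fact b * fact l / fact (r + d) * (of_nat r * of_nat (Suc b) * fact (r + d) / fact (Suc d)))) * fps_nth (P ^ Suc d) (Suc b)"
    unfolding LQ by (simp only: const_mult mult.assoc)
  also have "1 / of_nat r * (fact b * fact l / fact (r + d) * (of_nat r * of_nat (Suc b) * fact (r + d) / fact (Suc d)))
      = (fact (Suc b) * fact l / fact (Suc d) :: complex)"
    using r by (simp add: field_simps del: of_nat_Suc)
  finally have "F_scaled k r f - const (fact (Suc b) * fact l / fact (Suc d)) * fps_nth (P ^ Suc d) (Suc b)
      = const (1 / of_nat r) * (F_op k r f - ?L f + ?L h)" by simp
  then show ?case
    using mdeg_ge_const_mult[OF mdeg_ge_add[OF 1 2]] by (simp add: f_def)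
qed

text \<open>With \<open>d = 0\<close> the error has degree at least 2 and misses the linear monomial
  that \<open>J\<close> extracts.\<close>

lemma lookup_J_F_scaled_power:
  assumes "l = (r - 1) * b + 1" "\<phi> 0 = 1"
  shows "Poly_Mapping.lookup (J (int (e b)) ((F_scaled k r ^^ b) (p_var (e 0) ^ l))) 0 = of_nat (e b) * fact b * fact l * \<phi> b"
proof -
  let ?f = "(F_scaled k r ^^ b) (p_var (e 0) ^ l)"
  let ?a = "Poly_Mapping.single (e b - 1) (1::nat)"
  have "mdeg_ge 2 (?f - const (fact b * fact l) * fps_nth P b)"
    using F_scaled_power[of b 0 l] assms by simp
  then have "Poly_Mapping.lookup (?f - const (fact b * fact l) * fps_nth P b) ?a = 0"
    by (rule mdeg_geD) simp
  then have "Poly_Mapping.lookup ?f ?a = fact b * fact l * \<phi> b"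
    by (simp add: lookup_minus lookup_const_mult P_def p_var_def)
  then show ?thesis
    using e_pos[of b] by (simp add: J_def scal_def lookup_const_mult lookup_p_deriv del: single_of_nat)
qed

end

section \<open>The one-part numbers\<close>

lemma mdeg_ge_trivial: "mdeg_ge 0 f"
  by (simp add: mdeg_ge_def)

lemma lookup_0_eq_0: "mdeg_ge 1 f \<Longrightarrow> Poly_Mapping.lookup f 0 = 0"
  by (erule mdeg_geD) (simp add: mdeg_def)

lemma lookup_J_neg_0: "j < 0 \<Longrightarrow> Poly_Mapping.lookup (J j f) 0 = 0"
  using mdeg_ge_J_neg[OF mdeg_ge_trivial] by (intro lookup_0_eq_0) simp

text \<open>The index sum \<open>- k\<close> is negative, so every normally ordered term has a
  creation operator leftmost.\<close>

lemma lookup_F_scaled_0: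
  assumes "k > 0"
  shows "Poly_Mapping.lookup (F_scaled k r f) 0 = 0"
proof -
  have "Poly_Mapping.lookup (normal_ordered js f) 0 = 0" if js: "js \<in> E_support (- int k) f" for js
  proof -
    have "sum_list js < 0" using js assms by (simp add: E_support_def)
    then have "filter (\<lambda>j. j < 0) js \<noteq> []"
      using sum_list_nonneg[of js] by (force simp: filter_empty_conv)
    then obtain j js' where j: "filter (\<lambda>j. j < 0) js = j # js'" by (cases "filter (\<lambda>j. j < 0) js") auto
    then have "j \<in> set (filter (\<lambda>j. j < 0) js)" by simp
    then have "j < 0" by simp
    then show ?thesis unfolding normal_ordered_eq j J_prod_Cons by (rule lookup_J_neg_0)
  qed
  then show ?thesis
    by (simp add: F_scaled_def F_op_def E_coeff_def scal_def lookup_const_mult lookup_sum)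
qed

text \<open>
  If all factors but the first produce polynomials without constant term, then a block not
  containing the first factor has vanishing expectation, so only the one-block partition survives.
\<close>

lemma connected_vev_Cons:
  assumes zero: "\<And>B f. B \<in> set Bs \<Longrightarrow> Poly_Mapping.lookup (B f) 0 = 0"
  shows "connected_vev (A # Bs) = vev (op_prod (A # Bs))"
proof -
  let ?I = "{..<length (A # Bs)}"
  let ?h = "\<lambda>\<pi>. (-1) ^ (card \<pi> - 1) * fact (card \<pi> - 1) * (\<Prod>B\<in>\<pi>. vev (op_prod (nths (A # Bs) B)))"
  have vanish: "?h \<pi> = 0" if \<pi>: "partition_on ?I \<pi>" and ne: "\<pi> \<noteq> {?I}" for \<pi>
  proof -
    have un: "\<Union>\<pi> = ?I" and dis: "disjoint \<pi>" and no: "{} \<notin> \<pi>" using \<pi> by (auto simp: partition_on_def)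
    \<comment> \<open>Disjoint blocks cannot share the element 0, so if all contained it there would
      be only one block.\<close>
    have "\<exists>B\<in>\<pi>. 0 \<notin> B"
    proof (rule ccontr)
      assume "\<not> (\<exists>B\<in>\<pi>. 0 \<notin> B)"
      then have all: "\<And>B. B \<in> \<pi> \<Longrightarrow> 0 \<in> B" by blast
      obtain C where C: "C \<in> \<pi>" using un by auto
      have "B = C" if "B \<in> \<pi>" for B
        using dis all[OF that] all[OF C] that C by (auto simp: disjoint_def)
      then have "\<pi> = {C}" using C by blast
      then show False using un ne by simp
    qed
    then obtain B where B: "B \<in> \<pi>" "0 \<notin> B" by blast
    then obtain i where i: "i \<in> B" using no by (metis ex_in_conv)
    then obtain i' where i': "i = Suc i'" using B(2) by (cases i) auto
    \<comment> \<open>Position 0 belongs to \<open>A\<close>, hence the shift by one. The block is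
      nonempty, so its product starts with a factor from \<open>Bs\<close>.\<close>
    define Cs where "Cs = nths Bs {j. Suc j \<in> B}"
    have nths: "nths (A # Bs) B = Cs" using B(2) by (simp add: nths_Cons Cs_def)
    have "i' < length Bs" using i i' B(1) un by auto
    then have "Bs ! i' \<in> set Cs" using i i' by (auto simp: Cs_def set_nths)
    then obtain C Cs' where C: "Cs = C # Cs'" by (cases Cs) auto
    then have "C \<in> set Bs" using set_nths_subset[of Bs "{j. Suc j \<in> B}"] by (auto simp: Cs_def)
    then have "vev (op_prod (nths (A # Bs) B)) = 0"
      unfolding nths C by (simp add: vev_def op_prod_def zero)
    moreover have "finite \<pi>" using \<pi> by (rule finite_elements[rotated]) simp
    ultimately have "(\<Prod>B\<in>\<pi>. vev (op_prod (nths (A # Bs) B))) = 0"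
      using B(1) by (auto simp: prod_zero_iff)
    then show ?thesis by simp
  qed
  have "connected_vev (A # Bs) = (\<Sum>\<pi>\<in>{{?I}}. ?h \<pi>)"
    unfolding connected_vev_def
  proof (rule sum.mono_neutral_right)
    show "finite {\<pi>. partition_on ?I \<pi>}" by (rule finitely_many_partition_on) simp
    show "{{?I}} \<subseteq> {\<pi>. partition_on ?I \<pi>}" by (auto simp: partition_on_def)
  qed (use vanish in auto)
  also have "\<dots> = vev (op_prod (A # Bs))" by (simp add: nths_all)
  finally show ?thesis .
qed

lemma op_prod_replicate: "op_prod (replicate n A) f = (A ^^ n) f"
  by (induction n) (simp_all add: op_prod_def)

lemma J_neg_power: "q > 0 \<Longrightarrow> (J (- int q) ^^ l) 1 = p_var q ^ l"
  by (induction l) (simp_all add: J_def)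

section \<open>Solving the recursion by Rothe numbers\<close>

definition mexp :: "nat \<Rightarrow> nat \<Rightarrow> nat \<Rightarrow> nat \<Rightarrow> nat" where
  "mexp k r q j = q + j * (q * (r - 1) + k)"

text \<open>
  The numbers \<open>mexp k r q j * phi k r q j\<close> are a geometric progression times Rothe numbers. The argument
  \<open>\<alpha> + 1\<close> and the slope \<open>\<beta> = \<alpha> (r - 1) + r\<close> are chosen such that \<open>r (\<alpha> + 1) + \<beta> n = \<alpha> + \<beta> (n + 1)\<close>,
  so both sides of the recursion involve the same binomial coefficient.
\<close>

definition phi :: "nat \<Rightarrow> nat \<Rightarrow> nat \<Rightarrow> nat \<Rightarrow> complex" where
  "phi k r q j = (let \<alpha> = of_nat r * of_nat q / of_nat k in
     of_nat q * (of_nat q ^ (r - 1) * (of_nat k / of_nat r)) ^ j *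
     rothe (\<alpha> * (of_nat r - 1) + of_nat r) (\<alpha> + 1) j / of_nat (mexp k r q j))"

text \<open>Division by \<open>k\<close> turns the upper argument of the binomial coefficient into
  \<open>m / A\<close> for \<open>A = k / r\<close> and \<open>m = mexp k r q n\<close>.\<close>

lemma mexp_upper:
  fixes k r q n :: nat
  assumes "k > 0" "r > 0"
  defines "\<alpha> \<equiv> of_nat r * of_nat q / of_nat k :: complex"
  defines "\<beta> \<equiv> \<alpha> * (of_nat r - 1) + of_nat r"
  shows "of_nat k * (\<alpha> + \<beta> * of_nat n) = of_nat r * of_nat (mexp k r q n)"
proof -
  have k\<alpha>: "of_nat k * \<alpha> = of_nat r * of_nat q" using assms(1) by (simp add: \<alpha>_def)
  have r1: "of_nat (r - 1) = (of_nat r - 1 :: complex)" using assms(2) by simp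
  have "of_nat k * (\<alpha> + \<beta> * of_nat n) = of_nat k * \<alpha> * (1 + (of_nat r - 1) * of_nat n) + of_nat k * of_nat r * of_nat n"
    by (simp add: \<beta>_def algebra_simps)
  also have "\<dots> = of_nat r * of_nat (mexp k r q n)"
    unfolding k\<alpha> mexp_def of_nat_add of_nat_mult r1 by (simp add: algebra_simps)
  finally show ?thesis .
qed

lemma tree_flow_phi:
  assumes k: "k > 0" and r: "r > 0" and q: "q > 0"
  shows "tree_flow k r (mexp k r q) (phi k r q)"
proof
  show "k > 0" "r > 0" by fact+
  show e_pos: "mexp k r q j > 0" for j using q by (simp add: mexp_def)
  show "inj (mexp k r q)" using k by (auto simp: inj_def mexp_def)
  show "k + sum_list (map (mexp k r q) js) = mexp k r q (Suc (sum_list js))" if "length js = r" for js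
  proof -
    have "sum_list (map (mexp k r q) js) = length js * q + sum_list js * (q * (r - 1) + k)"
      unfolding mexp_def by (induction js) (simp_all add: distrib_right)
    moreover have "r * q = q * (r - 1) + q" using r by (cases r) simp_all
    ultimately show ?thesis using that by (simp add: mexp_def)
  qed
  fix n
  define \<alpha> :: complex where "\<alpha> = of_nat r * of_nat q / of_nat k"
  define \<beta> where "\<beta> = \<alpha> * (of_nat r - 1) + of_nat r"
  define t :: complex where "t = of_nat q ^ (r - 1) * (of_nat k / of_nat r)"
  define M :: "nat \<Rightarrow> complex" where "M j = of_nat (mexp k r q j)" for j
  have M0: "M j \<noteq> 0" for j using e_pos[of j] unfolding M_def by (metis of_nat_eq_0_iff less_irrefl)
  have phi: "phi k r q j = of_nat q * t ^ j * rothe \<beta> (\<alpha> + 1) j / M j" for j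
    by (simp add: phi_def Let_def \<alpha>_def \<beta>_def t_def M_def)
  have r0: "of_nat r \<noteq> (0::complex)" and k0: "of_nat k \<noteq> (0::complex)" using r k by simp_all
  have rk: "of_nat r * M (Suc n) = of_nat k * (\<alpha> + \<beta> * of_nat (Suc n))"
    unfolding M_def \<alpha>_def \<beta>_def using k r by (rule mexp_upper[symmetric])
  \<comment> \<open>The upper argument common to both sides of the recursion. By \<open>rk\<close>
    it is nonzero and can be cancelled.\<close>
  let ?y = "\<alpha> + \<beta> * of_nat (Suc n)"
  have y0: "?y \<noteq> 0" using rk r0 M0[of "Suc n"] by (metis mult_eq_0_iff)
  have y: "of_nat r * (\<alpha> + 1) + \<beta> * of_nat n = ?y" by (simp add: \<beta>_def algebra_simps)
  have y': "\<alpha> + 1 + \<beta> * of_nat (Suc n) - 1 = ?y" by simp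
  \<comment> \<open>A step uses up \<open>r\<close> factors \<open>q\<close> and must return one,
    which explains the exponent \<open>r - 1\<close> in \<open>t\<close>.\<close>
  have qt: "of_nat q * t = of_nat q ^ r * (of_nat k / of_nat r)"
    using r unfolding t_def by (cases r) simp_all
  have rec: "of_nat k * of_nat (Suc n) * rothe \<beta> (\<alpha> + 1) (Suc n) = M (Suc n) * rothe \<beta> (of_nat r * (\<alpha> + 1)) n"
  proof -
    have 1: "of_nat (Suc n) * rothe \<beta> (\<alpha> + 1) (Suc n) = (\<alpha> + 1) * (?y gchoose n)"
      unfolding rothe_def y' by (simp del: of_nat_Suc)
    have 2: "?y * rothe \<beta> (of_nat r * (\<alpha> + 1)) n = of_nat r * (\<alpha> + 1) * (?y gchoose n)"
      using rothe_gbinomial[of "of_nat r * (\<alpha> + 1)" \<beta> n] unfolding y .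
    have "?y * (of_nat k * of_nat (Suc n) * rothe \<beta> (\<alpha> + 1) (Suc n)) = of_nat k * ?y * ((\<alpha> + 1) * (?y gchoose n))"
      unfolding 1[symmetric] by (simp only: mult_ac)
    also have "\<dots> = M (Suc n) * (of_nat r * (\<alpha> + 1) * (?y gchoose n))"
      unfolding rk[symmetric] by (simp only: mult_ac)
    also have "\<dots> = ?y * (M (Suc n) * rothe \<beta> (of_nat r * (\<alpha> + 1)) n)"
      unfolding 2[symmetric] by (simp only: mult_ac)
    finally show ?thesis using y0 by (simp only: mult_cancel_left) simp
  qed
  have "fps_nth (Abs_fps (\<lambda>j. of_nat (mexp k r q j) * phi k r q j) ^ r) n
      = fps_nth (Abs_fps (\<lambda>j. of_nat q * t ^ j * fps_nth (Abs_fps (rothe \<beta> (\<alpha> + 1))) j) ^ r) n"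
    using M0 by (simp add: phi flip: M_def)
  also have "\<dots> = of_nat q ^ r * t ^ n * rothe \<beta> (of_nat r * (\<alpha> + 1)) n"
    unfolding fps_scale_power rothe_power by simp
  also have "\<dots> = of_nat q ^ r * t ^ n * (of_nat k * of_nat (Suc n) * rothe \<beta> (\<alpha> + 1) (Suc n) / M (Suc n))"
    unfolding rec using M0[of "Suc n"] by simp
  also have "\<dots> = of_nat r * of_nat (Suc n) * ((of_nat q ^ r * (of_nat k / of_nat r)) * t ^ n * rothe \<beta> (\<alpha> + 1) (Suc n) / M (Suc n))"
    using r0 by (simp add: mult_ac del: of_nat_Suc)
  also have "\<dots> = of_nat r * of_nat (Suc n) * phi k r q (Suc n)"
    unfolding qt[symmetric] phi by (simp add: mult_ac del: of_nat_Suc)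
  finally show "of_nat r * of_nat (Suc n) * phi k r q (Suc n) =
      fps_nth (Abs_fps (\<lambda>j. of_nat (mexp k r q j) * phi k r q j) ^ r) n" by simp
qed

lemma phi_0: "q > 0 \<Longrightarrow> phi k r q 0 = 1"
  by (simp add: phi_def mexp_def Let_def)

text \<open>Since \<open>\<beta> - 1 = (\<alpha> + 1) * (r - 1)\<close>, the prefactor in
  \<open>rothe_gbinomial'\<close> is \<open>(\<alpha> + 1) * (b * (r - 1) + 1)\<close>, and
  \<open>\<alpha> + 1\<close> cancels.\<close>

lemma phi_closed_form:
  assumes k: "k > 0" and r: "r > 0" and q: "q > 0"
  shows "of_nat (mexp k r q b) * phi k r q b =
     of_nat q ^ ((r - 1) * b + 1) * (of_nat k / of_nat r) ^ b / (of_nat b * (of_nat r - 1) + 1) *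
       ((of_nat (mexp k r q b) / (of_nat k / of_nat r)) gchoose b)"
proof -
  define \<alpha> :: complex where "\<alpha> = of_nat r * of_nat q / of_nat k"
  define \<beta> where "\<beta> = \<alpha> * (of_nat r - 1) + of_nat r"
  define c :: complex where "c = of_nat b * (of_nat r - 1) + 1"
  have c: "c = of_nat (b * (r - 1) + 1)" using r by (simp add: c_def)
  then have c0: "c \<noteq> 0" by (metis of_nat_eq_0_iff add_is_0 one_neq_zero)
  have \<alpha>: "\<alpha> + 1 = of_nat (r * q + k) / of_nat k" using k by (simp add: \<alpha>_def field_simps)
  have \<alpha>0: "\<alpha> + 1 \<noteq> 0" unfolding \<alpha> using k by (metis add_is_0 divide_eq_0_iff less_irrefl of_nat_eq_0_iff)
  have "of_nat k * (\<alpha> + \<beta> * of_nat b) = of_nat r * of_nat (mexp k r q b)"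
    unfolding \<alpha>_def \<beta>_def using k r by (rule mexp_upper)
  then have upper: "\<alpha> + 1 + \<beta> * of_nat b - 1 = of_nat (mexp k r q b) / (of_nat k / of_nat r)"
    using k r by (simp add: field_simps)
  have "(\<alpha> + 1) * (c * rothe \<beta> (\<alpha> + 1) b) = (\<alpha> + 1 + (\<beta> - 1) * of_nat b) * rothe \<beta> (\<alpha> + 1) b"
    by (simp add: c_def \<beta>_def algebra_simps)
  also have "\<dots> = (\<alpha> + 1) * ((of_nat (mexp k r q b) / (of_nat k / of_nat r)) gchoose b)"
    unfolding rothe_gbinomial' upper ..
  finally have "c * rothe \<beta> (\<alpha> + 1) b = (of_nat (mexp k r q b) / (of_nat k / of_nat r)) gchoose b"
    using \<alpha>0 by (simp only: mult_cancel_left) simp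
  then have rothe: "rothe \<beta> (\<alpha> + 1) b = ((of_nat (mexp k r q b) / (of_nat k / of_nat r)) gchoose b) / c"
    using c0 by (simp add: field_simps)
  have "mexp k r q b \<noteq> 0" using q by (simp add: mexp_def)
  then have "of_nat (mexp k r q b) * phi k r q b =
      of_nat q * (of_nat q ^ (r - 1) * (of_nat k / of_nat r)) ^ b * rothe \<beta> (\<alpha> + 1) b"
    by (simp add: phi_def Let_def \<alpha>_def \<beta>_def)
  also have "\<dots> = of_nat q ^ ((r - 1) * b + 1) * (of_nat k / of_nat r) ^ b * rothe \<beta> (\<alpha> + 1) b"
    unfolding power_mult_distrib by (simp add: power_add mult_ac flip: power_mult)
  finally show ?thesis unfolding rothe c_def by simp
qed

section \<open>Evaluation of the one-part expectation\<close>

lemma lh0_one_part: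
  assumes k: "k > 0" and r: "r > 0" and q: "q > 0" and m: "m = mexp k r q b"
  shows "lh0 k r q [m] = fact b / (of_nat m * (of_nat b * (of_nat r - 1) + 1)) *
           ((of_nat m / (of_nat k / of_nat r)) gchoose b) * (of_nat k / of_nat r) ^ b"
proof -
  define l where "l = (r - 1) * b + 1"
  have r1: "of_nat r - 1 = (of_nat (r - 1) :: rat)" using r by simp
  have w: "of_nat q * (of_nat r - 1) + of_nat k = (of_nat (q * (r - 1) + k) :: rat)"
    unfolding r1 by simp
  have w0: "(of_nat (q * (r - 1) + k) :: rat) \<noteq> 0" using k by (metis add_is_0 less_irrefl of_nat_eq_0_iff)
  have "of_nat (sum_list [m]) + of_nat q * (of_nat (length [m]) - 2) = (of_nat b * of_nat (q * (r - 1) + k) :: rat)"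
    by (simp add: m mexp_def)
  then have lb: "lh_b k r q [m] = of_nat b"
    unfolding lh_b_def w using w0 by simp
  have ll: "lh_l k r q [m] = of_nat l"
    unfolding lh_l_def lb r1 l_def by simp
  interpret tree_flow k r "mexp k r q" "phi k r q"
    using k r q by (rule tree_flow_phi)
  let ?Bs = "replicate b (\<lambda>f. scal (1 / of_nat r) (F_op k r f)) @ replicate l (J (- int q))"
  have F: "(\<lambda>f. scal (1 / of_nat r) (F_op k r f)) = F_scaled k r"
    by (rule ext) (simp add: F_scaled_def)
  have "connected_vev (map (\<lambda>m. J (int m)) [m] @ ?Bs) = connected_vev (J (int m) # ?Bs)" by simp
  also have "\<dots> = vev (op_prod (J (int m) # ?Bs))"
    unfolding F by (rule connected_vev_Cons) (use q k in \<open>auto simp: lookup_F_scaled_0 lookup_J_neg_0\<close>)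
  also have "\<dots> = Poly_Mapping.lookup (J (int m) (op_prod ?Bs 1)) 0"
    by (simp add: vev_def op_prod_def)
  also have "op_prod ?Bs 1 = (F_scaled k r ^^ b) (p_var (mexp k r q 0) ^ l)"
    unfolding F using q by (simp add: op_prod_append op_prod_replicate J_neg_power mexp_def)
  also have "Poly_Mapping.lookup (J (int m) \<dots>) 0 = of_nat m * fact b * fact l * phi k r q b"
    unfolding m by (rule lookup_J_F_scaled_power) (simp_all add: l_def phi_0 q)
  finally have vev: "connected_vev (map (\<lambda>m. J (int m)) [m] @ ?Bs) = fact b * fact l * (of_nat m * phi k r q b)"
    by simp
  have "lh0 k r q [m] = 1 / (fact l * of_nat q ^ l * of_nat m) * (fact b * fact l * (of_nat m * phi k r q b))"
    unfolding lh0_def lb ll Let_def vev[symmetric] by simp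
  also have "of_nat m * phi k r q b = of_nat q ^ l * (of_nat k / of_nat r) ^ b / (of_nat b * (of_nat r - 1) + 1) *
       ((of_nat m / (of_nat k / of_nat r)) gchoose b)"
    unfolding m l_def using k r q by (rule phi_closed_form)
  \<comment> \<open>The factors \<open>fact l\<close> and \<open>q ^ l\<close> produced by the flow
    cancel the normalisation.\<close>
  also have "1 / (fact l * of_nat q ^ l * of_nat m) * (fact b * fact l * \<dots>)
      = fact b / (of_nat m * (of_nat b * (of_nat r - 1) + 1)) *
           ((of_nat m / (of_nat k / of_nat r)) gchoose b) * (of_nat k / of_nat r) ^ b"
    using q by simp
  finally show ?thesis .
qed

theorem theorem4p4:
  fixes r k m q :: nat and A b :: rat
  assumes "r > 0" and "k > 0" and "m > 0" and "q > 0"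
    and A_def: "A = of_nat k / of_nat r"
    and b_def: "b = (of_nat m - of_nat q) / (of_nat q * (of_nat r - 1) + of_nat k)"
  shows "(lh0 k r q [m] \<noteq> 0 \<longleftrightarrow> b \<in> \<nat>) \<and>
    (\<forall>n::nat. b = of_nat n \<longrightarrow>
       lh0 k r q [m] =
         of_rat (fact n / (of_nat m * (of_nat n * (of_nat r - 1) + 1)) *
                 ((of_nat m / A) gchoose n) * A ^ n))"
proof -
  let ?R = "\<lambda>n. fact n / (of_nat m * (of_nat n * (of_nat r - 1) + 1)) * ((of_nat m / A) gchoose n) * A ^ n"
  have r1: "of_nat r - 1 = (of_nat (r - 1) :: rat)" using assms(1) by simp
  have w: "of_nat q * (of_nat r - 1) + of_nat k = (of_nat (q * (r - 1) + k) :: rat)"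
    unfolding r1 by simp
  have w0: "(of_nat (q * (r - 1) + k) :: rat) \<noteq> 0"
    using assms(2) by (metis add_is_0 less_irrefl of_nat_eq_0_iff)
  have m: "m = mexp k r q n" if "b = of_nat n" for n
  proof -
    have "of_nat m = (of_nat q + of_nat n * of_nat (q * (r - 1) + k) :: rat)"
      using that w0 unfolding b_def w by (simp only: divide_eq_eq) (simp add: algebra_simps)
    then have "(of_nat m :: rat) = of_nat (mexp k r q n)" by (simp add: mexp_def)
    then show ?thesis by (simp only: of_nat_eq_iff)
  qed
  have lh0_eq: "lh0 k r q [m] = of_rat (?R n)" if "b = of_nat n" for n
    using lh0_one_part[OF assms(2,1,4) m[OF that]]
    by (simp add: A_def of_rat_mult of_rat_divide of_rat_add of_rat_diff of_rat_power of_rat_gbinomial of_rat_fact)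
  have nonzero: "?R n \<noteq> 0" if "b = of_nat n" for n
  proof -
    \<comment> \<open>This gives \<open>m / A \<ge> n\<close>, the range in which the binomial
      coefficient is bounded below by a positive power.\<close>
    have "n * k \<le> m * r"
    proof -
      have "n * k \<le> m" unfolding m[OF that] mexp_def by (simp add: algebra_simps)
      also have "\<dots> \<le> m * r" using assms(1) by simp
      finally show ?thesis .
    qed
    then have "of_nat n * of_nat k \<le> (of_nat m * of_nat r :: rat)" by (simp flip: of_nat_mult)
    then have n: "of_nat n \<le> of_nat m / A" using assms(1,2) by (simp add: A_def field_simps)
    \<comment> \<open>For \<open>n = 0\<close> the quotient by zero is harmless, its power being
      1.\<close>
    have "0 < (of_nat m / A / of_nat n) ^ n"
      using assms(1-3) by (cases "n = 0") (simp_all add: A_def)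
    also have "\<dots> \<le> (of_nat m / A) gchoose n" by (rule gbinomial_ge_n_over_k_pow_k[OF n])
    finally have "(of_nat m / A) gchoose n \<noteq> 0" by simp
    moreover have "of_nat n * (of_nat r - 1) + 1 \<noteq> (0 :: rat)"
      unfolding r1 by (metis add_is_0 of_nat_1 of_nat_add of_nat_eq_0_iff of_nat_mult one_neq_zero)
    ultimately show ?thesis using assms(1-3) by (simp add: A_def)
  qed
  have "lh0 k r q [m] = 0" if "b \<notin> \<nat>"
    using that by (simp add: lh0_def lh_b_def b_def)
  moreover have "lh0 k r q [m] \<noteq> 0" if "b \<in> \<nat>"
    using that lh0_eq nonzero by (metis Nats_cases of_rat_eq_0_iff)
  ultimately show ?thesis using lh0_eq by blast
qed

end
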